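(* Let $0<\eta<1/2$ and $0<\varepsilon_2<1/20$. There exists $\varepsilon_0=\varepsilon_0(\eta,\varepsilon_2)>0$ such that, for every fixed $0<\varepsilon_1<\varepsilon_0$, for infinitely many pairs $(d,n)$ of positive integers there is a $d$-regular $n$-vertex graph $G$ such that (1) $G$ is an $(\varepsilon_1,\varepsilon_2 d)$-expander; (2) $c(G)<\eta n$; (3) $d=\left(\tfrac12+o_d(1)\right)\log^2 n$, where $o_d(1)$ denotes a function of $d$ that tends to $0$ as $d\to\infty$ (for fixed $\eta,\varepsilon_1,\varepsilon_2$).
   Context: Graphs are finite and simple. All logarithms are natural, and $\log^2 x$ means $(\log x)^2$. The circumference $c(G)$ of a graph $G$ is the maximum length of a cycle in $G$. For a graph $G$ and $X\subseteq V(G)$, let $N_G(X):=\{v\in V(G)\setminus X: v\text{ has a neighbor in }X\}$ be the external neighborhood of $X$. Given reals $\varepsilon_1>0$ and $k>0$, define $\rho(x)=\rho(x;\varepsilon_1,k):=0$ if $x<k/5$, and $\rho(x)=\rho(x;\varepsilon_1,k):=\dfrac{\varepsilon_1}{\log^2(15x/k)}$ if $x\ge k/5$. A graph $G$ is an $(\varepsilon_1,k)$-expander if $|N_G(X)|\ge \rho(|X|;\varepsilon_1,k)\,|X|$ for every $X\subseteq V(G)$ with $k/2\le |X|\le |V(G)|/2$. *)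

theory Defs
  imports Complex_Main "Graph_Theory.Arc_Walk"
begin

text \<open>
  Finite simple graphs are the \<^locale>\<open>graph\<close>s of Graph_Theory: finite symmetric digraphs
  without loops and multiple arcs, each undirected edge being a pair of opposite arcs.
  So the out-degree of a vertex is its degree.
\<close>

definition regular :: "('a, 'b) pre_digraph \<Rightarrow> nat \<Rightarrow> bool" where
  "regular G d \<longleftrightarrow> (\<forall>v \<in> verts G. out_degree G v = d)"

definition ext_nbhd :: "('a, 'b) pre_digraph \<Rightarrow> 'a set \<Rightarrow> 'a set" where
  "ext_nbhd G X = {v \<in> verts G - X. \<exists>x \<in> X. v \<rightarrow>\<^bsub>G\<^esub> x}"

text \<open>
  The library counts the closed walk along an edge and back as a cycle (of length 2) of a
  symmetric digraph; the bound on the length excludes it. For \<^typ>\<open>nat\<close>, the supremum of a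
  finite nonempty set is its maximum, and that of the empty set is 0, so forests have
  circumference 0.
\<close>

definition circumference :: "('a, 'b) pre_digraph \<Rightarrow> nat" where
  "circumference G = Sup {length p |p. pre_digraph.cycle G p \<and> 3 \<le> length p}"

definition rho :: "real \<Rightarrow> real \<Rightarrow> real \<Rightarrow> real" where
  "rho \<epsilon>\<^sub>1 k x = (if x < k / 5 then 0 else \<epsilon>\<^sub>1 / (ln (15 * x / k))\<^sup>2)"

definition expander :: "real \<Rightarrow> real \<Rightarrow> ('a, 'b) pre_digraph \<Rightarrow> bool" where
  "expander \<epsilon>\<^sub>1 k G \<longleftrightarrow>
     (\<forall>X. X \<subseteq> verts G \<and> k / 2 \<le> real (card X) \<and> real (card X) \<le> real (card (verts G)) / 2 \<longrightarrow>
        real (card (ext_nbhd G X)) \<ge> rho \<epsilon>\<^sub>1 k (real (card X)) * real (card X))"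

end

theory Submission
  imports Defs "HOL-Combinatorics.Permutations" "HOL-Library.Disjoint_Sets" "HOL-Real_Asymp.Real_Asymp"
begin

text \<open>
  A graph in which deleting $s$ vertices leaves many more than $s$ components has no long cycle,
  and this can be made compatible with expansion as long as the components are about as small
  as the degree.

  Fix a large integer $r$ and let $d = 8lr$. Take $rs$ clusters, each a clique on $d+1$ vertices
  from which a perfect matching on $8l$ of the vertices, the ports, has been removed, and $s$ further
  vertices, the hubs. Join every port to one hub so that every hub receives $d$ ports; the counts
  agree, since $rs \cdot 8l = s \cdot 8lr$. The graph is $d$-regular.

  A cycle that is not confined to one cluster leaves each cluster that it visits through a hub, and
  different clusters use different hubs. So it visits at most $s$ of the $rs$ clusters, and
  has length at most $s(d+2)$, about the fraction $1/r$ of all vertices (\<open>circumference_le\<close>).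

  For the expansion the ports are assigned to the hubs at random. A union bound
  (\<open>exists_spreading_attachment\<close>) gives an assignment in which any half of the ports of a small family
  of $j$ clusters sees more than $lj$ hubs, and any quarter of all clusters sees almost
  all hubs. It needs $s$ to be at most exponential in $l$; here $s$ is only
  $\exp(\sqrt{2d})$. Let $X$ have at most half of the vertices. If much of $X$ lies in clusters that
  it meets but fills only partly, then the missing vertices of these clusters are neighbours. If much of $X$
  consists of hubs, their $d$ ports each are far more than $|X|$ vertices. Otherwise $X$ nearly fills
  many clusters, and then their ports see many hubs; either these hubs are neighbours of $X$, or $X$
  contains so many hubs that it has neighbours or partly filled clusters in abundance. The outcome
  (\<open>expansion_dichotomy\<close>) is that $|N(X)| \ge |X|/(64r)$, except that for $X$ at least of the order of
  $rs$ the guarantee is only $|N(X)| \ge s/64$.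

  The weaker guarantee is where the relation between $d$ and $n$ enters. For such $X$ the
  logarithm in the definition of the expansion rate is at least $\sqrt d$ because
  $s$ is exponential in $\sqrt d$; the required number of neighbours is then at most
  $\varepsilon_1 n/(2d)$, which is of the order of the number $rs$ of clusters. Finally $n$ is
  $\exp(\sqrt{2d})$ up to a polynomial factor in $d$, so $\log^2 n$ is asymptotically $2d$.
\<close>

section \<open>Random assignments with fibres of equal size\<close>

definition perms_into :: "'a set \<Rightarrow> 'a set \<Rightarrow> 'a set \<Rightarrow> ('a \<Rightarrow> 'a) set" where
  "perms_into U A B = {\<pi>. \<pi> permutes U \<and> \<pi> ` A \<subseteq> B}"

lemma finite_perms_into: "finite U \<Longrightarrow> finite (perms_into U A B)"
  unfolding perms_into_def by (rule finite_subset[OF _ finite_permutations]) auto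

text \<open>
  Given the values of a random permutation on \<open>A\<close>, its value at \<open>x\<close> is uniform on the remaining
  points. This is made precise by double counting: composing with the
  transposition of \<open>x\<close> and \<open>z\<close> moves the value that was required at \<open>x\<close> to an arbitrary place \<open>z\<close>
  outside \<open>A\<close>.
\<close>

lemma card_perms_into_insert:
  assumes "finite U" "insert x A \<subseteq> U" "x \<notin> A" "B \<subseteq> U"
  shows "(card U - card A) * card (perms_into U (insert x A) B)
    \<le> (card B - card A) * card (perms_into U A B)"
proof -
  have fin: "finite A" "finite B"
    using assms by (auto intro: finite_subset)
  let ?L = "perms_into U (insert x A) B \<times> (U - A)"
  let ?R = "SIGMA \<pi>:perms_into U A B. {z \<in> U - A. \<pi> z \<in> B}"
  let ?h = "\<lambda>(\<pi>, z). (\<pi> \<circ> transpose x z, z)"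
  have "inj_on ?h ?L"
  proof (rule inj_onI, clarsimp)
    fix \<pi> \<pi>' :: "'a \<Rightarrow> 'a" and z
    assume "\<pi> \<circ> transpose x z = \<pi>' \<circ> transpose x z"
    then have "(\<pi> \<circ> transpose x z) \<circ> transpose x z = (\<pi>' \<circ> transpose x z) \<circ> transpose x z"
      by simp
    then show "\<pi> = \<pi>'" by (simp add: o_assoc[symmetric])
  qed
  moreover have "?h ` ?L \<subseteq> ?R"
  proof (rule image_subsetI)
    fix w assume "w \<in> ?L"
    then obtain \<pi> z where w: "w = (\<pi>, z)" and p: "\<pi> \<in> perms_into U (insert x A) B"
      and z: "z \<in> U" "z \<notin> A" by auto
    have "\<pi> \<circ> transpose x z permutes U"
      using p z assms by (intro permutes_compose permutes_swap_id) (auto simp: perms_into_def)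
    moreover have "(\<pi> \<circ> transpose x z) a = \<pi> a" if "a \<in> A" for a
      using that z assms(3) by (auto simp: transpose_def)
    ultimately show "?h w \<in> ?R"
      using p z w by (auto simp: perms_into_def image_subset_iff)
  qed
  moreover have "finite ?R"
    using assms(1) finite_perms_into by (intro finite_SigmaI) auto
  ultimately have "card ?L \<le> card ?R"
    by (metis (no_types, lifting) card_image card_mono)
  moreover have "card {z \<in> U - A. \<pi> z \<in> B} = card B - card A" if "\<pi> \<in> perms_into U A B" for \<pi>
  proof -
    have p: "\<pi> permutes U" "\<pi> ` A \<subseteq> B" using that by (auto simp: perms_into_def)
    have inj: "inj_on \<pi> X" for X using permutes_inj_on[OF p(1)] .
    have "\<pi> ` {z \<in> U - A. \<pi> z \<in> B} = B - \<pi> ` A"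
    proof (intro equalityI subsetI)
      fix b assume b: "b \<in> B - \<pi> ` A"
      then have "b \<in> \<pi> ` U" using permutes_image[OF p(1)] assms(4) by auto
      then show "b \<in> \<pi> ` {z \<in> U - A. \<pi> z \<in> B}" using b by auto
    next
      fix b assume "b \<in> \<pi> ` {z \<in> U - A. \<pi> z \<in> B}"
      then show "b \<in> B - \<pi> ` A" using permutes_inj[OF p(1)] by (auto dest: injD)
    qed
    then have "card {z \<in> U - A. \<pi> z \<in> B} = card (B - \<pi> ` A)"
      using card_image[OF inj] by metis
    also have "\<dots> = card B - card A"
      using p(2) fin card_image[OF inj, of A] by (simp add: card_Diff_subset)
    finally show ?thesis .
  qed
  ultimately show ?thesis
    using assms fin finite_perms_into[OF assms(1)]
    by (simp add: card_cartesian_product card_SigmaI card_Diff_subset mult.commute)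
qed

text \<open>
  A random permutation of \<open>U\<close> maps \<open>A\<close> into \<open>B\<close> with probability at most
  $(|B|/|U|)^{|A|}$, as if the values were independent: conditioning on earlier values in \<open>B\<close> only
  makes a further one less likely.
\<close>

lemma card_perms_into_le:
  assumes "finite U" "A \<subseteq> U" "B \<subseteq> U"
  shows "card (perms_into U A B) * card U ^ card A \<le> fact (card U) * card B ^ card A"
proof -
  have "finite A" using assms finite_subset by blast
  then show ?thesis using assms(2)
  proof (induction A rule: finite_induct)
    case empty
    have "card (perms_into U {} B) = fact (card U)"
      using card_permutations[OF refl assms(1)] by (simp add: perms_into_def)
    then show ?case by simp
  next
    case (insert x A)
    let ?N = "card U" and ?a = "card A" and ?b = "card B"
    let ?F = "card (perms_into U A B)" and ?F' = "card (perms_into U (insert x A) B)"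
    have lt: "?a < ?N"
      using insert.hyps insert.prems assms(1) by (intro psubset_card_mono) auto
    have bN: "?b \<le> ?N" using assms by (simp add: card_mono)
    have "(?b - ?a) * ?N \<le> ?b * (?N - ?a)"
      using bN by (auto simp: diff_mult_distrib diff_mult_distrib2 mult.commute intro: diff_le_mono2)
    then have "?F' * ?N * (?N - ?a) \<le> ?F * ?b * (?N - ?a)"
      using card_perms_into_insert[OF assms(1) insert.prems insert.hyps(2) assms(3)]
      by (smt (verit, ccfv_threshold) mult.assoc mult.commute mult_le_mono1 mult_le_mono2 order_trans)
    then have step: "?F' * ?N \<le> ?F * ?b" using lt by simp
    have "?F' * ?N ^ Suc ?a = (?F' * ?N) * ?N ^ ?a" by simp
    also have "\<dots> \<le> (?F * ?b) * ?N ^ ?a" using step by (rule mult_le_mono1)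
    also have "\<dots> = (?F * ?N ^ ?a) * ?b" by simp
    also have "\<dots> \<le> (fact ?N * ?b ^ ?a) * ?b"
      using insert.IH insert.prems by (intro mult_le_mono1) auto
    finally show ?case using insert.hyps by (simp add: mult_ac)
  qed
qed

text \<open>
  Composing a fixed map \<open>g\<close> whose fibres all have \<open>d\<close> elements with a random permutation gives a
  uniformly random map with such fibres.
\<close>

lemma card_balanced_perms_le:
  fixes g :: "'a \<Rightarrow> 'b"
  assumes "finite U" "finite H" "card U = d * card H" "d > 0" "H \<noteq> {}"
    and fib: "\<And>h. h \<in> H \<Longrightarrow> card {u \<in> U. g u = h} = d"
    and "A \<subseteq> U" "T \<subseteq> H"
  shows "real (card {\<pi>. \<pi> permutes U \<and> g ` \<pi> ` A \<subseteq> T})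
    \<le> fact (card U) * (real (card T) / real (card H)) ^ card A"
proof -
  let ?B = "{u \<in> U. g u \<in> T}"
  have "?B = (\<Union>h\<in>T. {u \<in> U. g u = h})" by auto
  also have "card \<dots> = (\<Sum>h\<in>T. card {u \<in> U. g u = h})"
    using assms by (intro card_UN_disjoint) (auto intro: finite_subset)
  also have "\<dots> = d * card T"
    using assms by (simp add: subset_iff)
  finally have B: "card ?B = d * card T" .
  have "{\<pi>. \<pi> permutes U \<and> g ` \<pi> ` A \<subseteq> T} \<subseteq> perms_into U A ?B"
    using assms(7) by (auto simp: perms_into_def permutes_in_image)
  then have "real (card {\<pi>. \<pi> permutes U \<and> g ` \<pi> ` A \<subseteq> T}) \<le> real (card (perms_into U A ?B))"
    using finite_perms_into[OF assms(1)] by (simp add: card_mono)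
  also have "\<dots> \<le> fact (card U) * (real (card T) / real (card H)) ^ card A"
  proof -
    have "real (card (perms_into U A ?B) * card U ^ card A)
        \<le> real (fact (card U) * card ?B ^ card A)"
      using card_perms_into_le[OF assms(1,7), of ?B] by (simp only: of_nat_le_iff) auto
    moreover have "card H > 0" using assms by (simp add: card_gt_0_iff)
    ultimately show ?thesis
      using assms(3,4) unfolding B by (simp add: power_mult_distrib field_simps power_divide)
  qed
  finally show ?thesis .
qed

lemma finite_subsets_with: "finite A \<Longrightarrow> finite {B. B \<subseteq> A \<and> R B}"
  by simp

text \<open>
  The term of index \<open>n\<close> in the exponential series of \<open>n\<close> is at most $e^n$.
\<close>

lemma power_self_le_fact: "real n ^ n \<le> 3 ^ n * fact n"
proof -
  have "real n ^ n / fact n \<le> exp (real n)"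
    using sum_le_suminf[OF summable_exp_generic[of "real n"], of "{n}"]
    by (simp add: exp_def divide_inverse mult.commute)
  also have "\<dots> = exp 1 ^ n" by (simp flip: exp_of_nat_mult)
  also have "\<dots> \<le> 3 ^ n" by (intro power_mono exp_le) simp
  finally show ?thesis by (simp add: field_simps)
qed

text \<open>
  The left-hand side bounds the probability that, for some family of \<open>j\<close> among \<open>m\<close> clusters, some half of
  its $8lj$ ports sees only some set of $lj$ hubs. The factors count the families, the sets of
  ports and the sets of hubs, and bound the probability for fixed choices. With
  $q = lj/s \le 1/16$, the number of sets of hubs is at most $(3/q)^{lj}$, and the surviving
  factor $q^{3lj}$ beats $2^{8lj}\,3^{lj}$ by more than $4^{lj}$, which also pays for the $m^j$ families.
\<close>

lemma small_set_union_bound: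
  fixes m l s j :: nat
  assumes "j > 0" "s > 0" "16 * (l * j) \<le> s" "4 * m \<le> 4 ^ l"
  shows "real m ^ j * 2 ^ (8 * l * j) * real (s choose (l * j)) *
    (real (l * j) / real s) ^ (4 * l * j) \<le> (1/4) ^ j"
proof -
  let ?t = "l * j" and ?q = "real (l * j) / real s"
  have ts: "?t \<le> s" using assms by linarith
  have "real (s choose ?t) * fact ?t \<le> real s ^ ?t"
    using binomial_fact_pow[of s ?t] by (metis of_nat_fact of_nat_le_iff of_nat_mult of_nat_power)
  then have "real (s choose ?t) * real ?t ^ ?t * fact ?t \<le> real s ^ ?t * (3 ^ ?t * fact ?t)"
    using power_self_le_fact[of ?t]
    by (smt (verit, ccfv_SIG) fact_ge_zero mult.commute mult.left_commute mult_mono of_nat_0_le_iff zero_le_power)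
  then have "real (s choose ?t) * real ?t ^ ?t \<le> real s ^ ?t * 3 ^ ?t"
    using fact_gt_zero[of ?t, where ?'a=real] by (simp add: mult.assoc[symmetric])
  then have ch: "real (s choose ?t) * ?q ^ ?t \<le> 3 ^ ?t"
    using assms by (simp add: power_divide field_simps)
  have q: "0 \<le> ?q" "?q \<le> 1/16" using assms by (auto simp: field_simps simp flip: of_nat_mult)
  have "?q ^ (4 * l * j) = ?q ^ ?t * ?q ^ (3 * ?t)"
    by (simp flip: power_add add: algebra_simps)
  then have "real (s choose ?t) * ?q ^ (4 * l * j) = (real (s choose ?t) * ?q ^ ?t) * ?q ^ (3 * ?t)"
    by simp
  also have "\<dots> \<le> 3 ^ ?t * (1/16) ^ (3 * ?t)"
    using ch q by (intro mult_mono power_mono) auto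
  finally have "2 ^ (8 * l * j) * (real (s choose ?t) * ?q ^ (4 * l * j)) \<le>
      2 ^ (8 * ?t) * (3 ^ ?t * (1/16) ^ (3 * ?t))"
    by (simp add: mult.assoc)
  also have "\<dots> = (2 ^ 8 * (3 * (1/16) ^ 3)) ^ ?t"
    by (simp only: power_mult power_mult_distrib)
  also have "\<dots> = (3/16) ^ ?t" by (rule arg_cong[of _ _ "\<lambda>x. x ^ ?t"]) (simp add: power_divide)
  also have "\<dots> \<le> (1/4) ^ ?t" by (intro power_mono) auto
  finally have "real m ^ j * (2 ^ (8 * l * j) * (real (s choose ?t) * ?q ^ (4 * l * j)))
      \<le> real m ^ j * (1/4) ^ ?t" by (intro mult_left_mono) auto
  also have "\<dots> = (real m / 4 ^ l) ^ j"
    by (simp add: power_divide power_mult)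
  also have "\<dots> \<le> (1/4) ^ j"
  proof (intro power_mono)
    have "real (4 * m) \<le> real (4 ^ l)" using assms(4) by (simp only: of_nat_le_iff)
    then show "real m / 4 ^ l \<le> 1/4" by (simp add: field_simps)
  qed auto
  finally show ?thesis by (simp add: mult.assoc)
qed

text \<open>
  The union bound. The first kind of failure, that some half of the ports of a small family of
  clusters sees too few hubs, has probability at most $\sum_{j \ge 1} 4^{-j} = 1/3$. The second
  kind, that some quarter of all clusters misses a sixty-fourth of the hubs, involves at least $2lm$
  ports for $m$ clusters; it has probability at most $2^m 2^s (63/64)^{2lm} \le 4^{-m}$. Here
  \<open>P i\<close> are the ports of cluster \<open>i\<close> and \<open>H\<close> is the set of hubs.
\<close>

lemma exists_spreading_attachment:
  fixes P :: "nat \<Rightarrow> 'v set" and H :: "'v set"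
  assumes "finite H" "card H = s" "s > 0" "l > 0" "r > 0"
    and P: "\<And>i. i < r * s \<Longrightarrow> finite (P i) \<and> card (P i) = 8 * l"
    and disj: "disjoint_family_on P {..<r * s}"
    and bounds: "4 * (r * s) \<le> 4 ^ l" "(63/64 :: real) ^ (2 * l) \<le> 1/16"
  obtains f :: "'v \<Rightarrow> 'v"
  where "\<And>i v. i < r * s \<Longrightarrow> v \<in> P i \<Longrightarrow> f v \<in> H"
    and "\<And>h. h \<in> H \<Longrightarrow> card {v \<in> (\<Union>i<r * s. P i). f v = h} = 8 * l * r"
    and "\<And>J A. J \<subseteq> {..<r * s} \<Longrightarrow> J \<noteq> {} \<Longrightarrow> card J \<le> s div (16 * l) \<Longrightarrow> A \<subseteq> (\<Union>i\<in>J. P i) \<Longrightarrow>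
           4 * l * card J \<le> card A \<Longrightarrow> l * card J < card (f ` A)"
    and "\<And>J. J \<subseteq> {..<r * s} \<Longrightarrow> r * s \<le> 4 * card J \<Longrightarrow> 63 * s < 64 * card (f ` (\<Union>i\<in>J. P i))"
proof -
  let ?m = "r * s" let ?U = "\<Union>i<?m. P i" let ?d = "8 * l * r"
  let ?j0 = "s div (16 * l)" and ?N = "card ?U"
  have m: "?m > 0" using assms by simp
  have ports: "finite (\<Union>i\<in>J. P i)" "card (\<Union>i\<in>J. P i) = 8 * l * card J" if "J \<subseteq> {..<?m}" for J
  proof -
    have fJ: "finite J" using that finite_subset by blast
    have "card (\<Union>i\<in>J. P i) = (\<Sum>i\<in>J. card (P i))"
      using that P disjoint_family_on_mono[OF that disj]
      by (intro card_UN_disjoint fJ) (auto simp: disjoint_family_on_def subset_iff)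
    also have "\<dots> = 8 * l * card J" using P that by (simp add: subset_iff)
    finally show "card (\<Union>i\<in>J. P i) = 8 * l * card J" .
    show "finite (\<Union>i\<in>J. P i)" using P that by (intro finite_UN_I fJ) auto
  qed
  have fU: "finite ?U" and cU: "?N = ?d * s"
    using ports[of "{..<?m}"] by auto
  have "card (H \<times> {..<?d}) = ?N" using assms cU by (simp add: card_cartesian_product)
  then obtain b where b: "bij_betw b ?U (H \<times> {..<?d})"
    using finite_same_card_bij[OF fU] assms(1) by (metis finite_cartesian_product finite_lessThan)
  define g where "g = fst \<circ> b"
  have gH: "g u \<in> H" if "u \<in> ?U" for u
    using bij_betwE[OF b] that unfolding g_def by (auto simp: mem_Times_iff)
  have fib: "card {u \<in> ?U. g u = h} = ?d" if "h \<in> H" for h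
  proof -
    have "b ` {u \<in> ?U. g u = h} = {h} \<times> {..<?d}"
    proof (intro equalityI subsetI)
      fix x assume "x \<in> b ` {u \<in> ?U. g u = h}"
      then show "x \<in> {h} \<times> {..<?d}"
        using bij_betwE[OF b] unfolding g_def by (auto simp: mem_Times_iff)
    next
      fix x assume x: "x \<in> {h} \<times> {..<?d}"
      then have "x \<in> b ` ?U" using b that by (auto simp: bij_betw_def)
      then obtain u where u: "u \<in> ?U" "x = b u" by (rule imageE)
      then have "g u = h" using x by (auto simp: g_def)
      then show "x \<in> b ` {u \<in> ?U. g u = h}" using u by blast
    qed
    moreover have "inj_on b {u \<in> ?U. g u = h}"
      using b unfolding bij_betw_def by (blast intro: inj_on_subset)
    ultimately have "card {u \<in> ?U. g u = h} = card ({h} \<times> {..<?d})"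
      by (metis (no_types, lifting) card_image)
    then show ?thesis by (simp add: card_cartesian_product)
  qed
  define S where "S A T = {\<pi>. \<pi> permutes ?U \<and> g ` \<pi> ` A \<subseteq> T}" for A T
  have finS: "finite (S A T)" for A T
    unfolding S_def using finite_permutations[OF fU] by (rule finite_subset[rotated]) auto
  have cS: "real (card (S A T)) \<le> fact ?N * (real (card T) / real s) ^ card A"
    if "A \<subseteq> ?U" "T \<subseteq> H" for A T
    unfolding S_def assms(2)[symmetric]
    by (rule card_balanced_perms_le[where d = ?d]) (use that assms fU cU fib in auto)

  define Q where "Q j = (SIGMA J:{J. J \<subseteq> {..<?m} \<and> card J = j}.
    {A. A \<subseteq> (\<Union>i\<in>J. P i) \<and> card A = 4 * l * j} \<times> {T. T \<subseteq> H \<and> card T = l * j})" for j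
  have finQ: "finite (Q j)" for j
    unfolding Q_def using assms(1) ports(1)
    by (intro finite_SigmaI finite_cartesian_product finite_subsets_with) auto
  have cQ: "real (card (Q j)) \<le> real ?m ^ j * 2 ^ (8 * l * j) * real (s choose (l * j))" for j
  proof -
    have "card (Q j) = (\<Sum>J\<in>{J. J \<subseteq> {..<?m} \<and> card J = j}.
        card ({A. A \<subseteq> (\<Union>i\<in>J. P i) \<and> card A = 4 * l * j} \<times> {T. T \<subseteq> H \<and> card T = l * j}))"
      unfolding Q_def using assms(1) ports(1)
      by (intro card_SigmaI ballI finite_cartesian_product finite_subsets_with) auto
    also have "\<dots> \<le> (\<Sum>J\<in>{J. J \<subseteq> {..<?m} \<and> card J = j}. 2 ^ (8 * l * j) * (s choose (l * j)))"
    proof (rule sum_mono)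
      fix J assume "J \<in> {J. J \<subseteq> {..<?m} \<and> card J = j}"
      then have "card {A. A \<subseteq> (\<Union>i\<in>J. P i) \<and> card A = 4 * l * j} \<le> 2 ^ (8 * l * j)"
        using n_subsets[OF ports(1), of J] ports(2)[of J] binomial_le_pow2 by auto
      then show "card ({A. A \<subseteq> (\<Union>i\<in>J. P i) \<and> card A = 4 * l * j} \<times> {T. T \<subseteq> H \<and> card T = l * j})
          \<le> 2 ^ (8 * l * j) * (s choose (l * j))"
        using n_subsets[OF assms(1)] assms(2) by (simp add: card_cartesian_product)
    qed
    also have "\<dots> = (?m choose j) * (2 ^ (8 * l * j) * (s choose (l * j)))"
      using n_subsets[of "{..<?m}" j] by simp
    also have "\<dots> \<le> ?m ^ j * (2 ^ (8 * l * j) * (s choose (l * j)))"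
      by (cases "j \<le> ?m") (auto intro!: mult_le_mono1 binomial_le_pow simp: binomial_eq_0)
    finally have "real (card (Q j)) \<le> real (?m ^ j * (2 ^ (8 * l * j) * (s choose (l * j))))"
      by (simp only: of_nat_le_iff)
    then show ?thesis by (simp add: mult.assoc)
  qed
  define Bad1 where "Bad1 = (\<Union>j\<in>{1..?j0}. \<Union>(J, A, T)\<in>Q j. S A T)"
  have "real (card Bad1) \<le> (\<Sum>j\<in>{1..?j0}. real (card (\<Union>(J, A, T)\<in>Q j. S A T)))"
    unfolding Bad1_def of_nat_sum[symmetric] of_nat_le_iff by (rule card_UN_le) simp
  also have "\<dots> \<le> (\<Sum>j\<in>{1..?j0}. fact ?N * (1/4) ^ j)"
  proof (rule sum_mono)
    fix j assume j: "j \<in> {1..?j0}"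
    have "16 * l * j \<le> 16 * l * ?j0" using j by simp
    also have "\<dots> \<le> s" by simp
    finally have jl: "16 * (l * j) \<le> s" by (simp add: mult.assoc)
    have "real (card (\<Union>(J, A, T)\<in>Q j. S A T)) \<le> (\<Sum>x\<in>Q j. real (card (case x of (J, A, T) \<Rightarrow> S A T)))"
      unfolding of_nat_sum[symmetric] of_nat_le_iff by (rule card_UN_le[OF finQ])
    also have "\<dots> \<le> (\<Sum>x\<in>Q j. fact ?N * (real (l * j) / real s) ^ (4 * l * j))"
    proof (rule sum_mono)
      fix x assume x: "x \<in> Q j"
      obtain J A T where [simp]: "x = (J, A, T)" by (cases x)
      show "real (card (case x of (J, A, T) \<Rightarrow> S A T)) \<le> fact ?N * (real (l * j) / real s) ^ (4 * l * j)"
        using cS[of A T] x unfolding Q_def by fastforce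
    qed
    also have "\<dots> = fact ?N * (real (card (Q j)) * (real (l * j) / real s) ^ (4 * l * j))"
      by simp
    also have "\<dots> \<le> fact ?N * (real ?m ^ j * 2 ^ (8 * l * j) * real (s choose (l * j)) *
        (real (l * j) / real s) ^ (4 * l * j))"
      by (intro mult_left_mono mult_right_mono cQ) auto
    also have "\<dots> \<le> fact ?N * (1/4) ^ j"
      using j assms jl by (intro mult_left_mono small_set_union_bound) auto
    finally show "real (card (\<Union>(J, A, T)\<in>Q j. S A T)) \<le> fact ?N * (1/4) ^ j" .
  qed
  also have "\<dots> = fact ?N * (\<Sum>j\<in>{1..?j0}. (1/4) ^ j)" by (simp add: sum_distrib_left)
  also have "(\<Sum>j\<in>{1..?j0}. (1/4 :: real) ^ j) \<le> 1/3"
  proof -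
    have "(\<Sum>j\<in>{1..n}. (1/4 :: real) ^ j) = (1 - (1/4) ^ n) / 3" for n
      by (induction n) (simp_all add: algebra_simps diff_divide_distrib)
    then show ?thesis by simp
  qed
  finally have bad1: "real (card Bad1) \<le> fact ?N * (1/3)" by simp

  define R where "R = {J. J \<subseteq> {..<?m} \<and> ?m \<le> 4 * card J} \<times> {T. T \<subseteq> H \<and> 64 * card T \<le> 63 * s}"
  have finR: "finite R" using assms(1) unfolding R_def by auto
  define Bad2 where "Bad2 = (\<Union>(J, T)\<in>R. S (\<Union>i\<in>J. P i) T)"
  have cR: "real (card R) \<le> 4 ^ ?m"
  proof -
    have "card R \<le> card (Pow {..<?m} \<times> Pow H)"
      using assms(1) unfolding R_def by (intro card_mono) auto
    also have "\<dots> = 2 ^ ?m * 2 ^ s" using assms(1,2) by (simp add: card_cartesian_product card_Pow)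
    also have "\<dots> \<le> 2 ^ ?m * 2 ^ ?m" using assms by simp
    finally have "real (card R) \<le> real (2 ^ ?m * 2 ^ ?m)" by (simp only: of_nat_le_iff)
    then show ?thesis by (simp flip: power_mult_distrib)
  qed
  have "real (card Bad2) \<le> (\<Sum>x\<in>R. real (card (case x of (J, T) \<Rightarrow> S (\<Union>i\<in>J. P i) T)))"
    unfolding Bad2_def of_nat_sum[symmetric] of_nat_le_iff by (rule card_UN_le[OF finR])
  also have "\<dots> \<le> (\<Sum>x\<in>R. fact ?N * (1/16) ^ ?m)"
  proof (rule sum_mono)
    fix x assume x: "x \<in> R"
    obtain J T where [simp]: "x = (J, T)" by (cases x)
    have J: "J \<subseteq> {..<?m}" "?m \<le> 4 * card J" and T: "T \<subseteq> H" "64 * card T \<le> 63 * s"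
      using x by (auto simp: R_def)
    have q: "real (card T) / real s \<le> 63/64" using T assms(3) by (simp add: field_simps)
    have "real (card (S (\<Union>i\<in>J. P i) T)) \<le> fact ?N * (real (card T) / real s) ^ (8 * l * card J)"
      using cS[of "\<Union>i\<in>J. P i" T] J T ports(2)[OF J(1)] by fastforce
    also have "\<dots> \<le> fact ?N * (63/64) ^ (8 * l * card J)"
      using q by (intro mult_left_mono power_mono) auto
    also have "\<dots> \<le> fact ?N * (63/64) ^ (2 * l * ?m)"
    proof (intro mult_left_mono power_decreasing)
      have "2 * l * ?m \<le> 2 * l * (4 * card J)" using J(2) by (rule mult_le_mono2)
      then show "2 * l * ?m \<le> 8 * l * card J" by simp
    qed auto
    also have "\<dots> = fact ?N * ((63/64) ^ (2 * l)) ^ ?m" by (simp add: power_mult)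
    also have "\<dots> \<le> fact ?N * (1/16) ^ ?m"
      using bounds(2) by (intro mult_left_mono power_mono) auto
    finally show "real (card (case x of (J, T) \<Rightarrow> S (\<Union>i\<in>J. P i) T)) \<le> fact ?N * (1/16) ^ ?m" by simp
  qed
  also have "\<dots> = fact ?N * (real (card R) * (1/16) ^ ?m)" by simp
  also have "\<dots> \<le> fact ?N * (4 ^ ?m * (1/16) ^ ?m)"
    by (intro mult_left_mono mult_right_mono cR) auto
  also have "\<dots> = fact ?N * (1/4) ^ ?m" by (simp flip: power_mult_distrib)
  also have "\<dots> \<le> fact ?N * (1/4)"
    using power_decreasing[of 1 ?m "1/4 :: real"] m by (intro mult_left_mono) auto
  finally have bad2: "real (card Bad2) \<le> fact ?N * (1/4)" .

  have "real (card (Bad1 \<union> Bad2)) \<le> real (card Bad1) + real (card Bad2)"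
    using card_Un_le[of Bad1 Bad2] by linarith
  also have "\<dots> < fact ?N" using bad1 bad2 fact_gt_zero[of ?N, where ?'a=real] by linarith
  also have "\<dots> = real (card {\<pi>. \<pi> permutes ?U})" using card_permutations[OF refl fU] by simp
  finally have "card (Bad1 \<union> Bad2) < card {\<pi>. \<pi> permutes ?U}" by simp
  moreover have finBad: "finite (Bad1 \<union> Bad2)" unfolding Bad1_def Bad2_def using finQ finR finS by auto
  ultimately have "\<not> {\<pi>. \<pi> permutes ?U} \<subseteq> Bad1 \<union> Bad2"
    using card_mono[OF finBad] leD by metis
  then obtain \<pi> where \<pi>: "\<pi> permutes ?U" "\<pi> \<notin> Bad1" "\<pi> \<notin> Bad2" by blast
  have inU: "\<pi> v \<in> ?U" if "v \<in> ?U" for v using permutes_in_image[OF \<pi>(1)] that by blast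
  have gpH: "(g \<circ> \<pi>) v \<in> H" if "v \<in> ?U" for v
    using gH[OF inU[OF that]] by simp
  have sub: "(\<Union>i\<in>J. P i) \<subseteq> ?U" if "J \<subseteq> {..<?m}" for J
    using that by (intro UN_mono) auto
  show thesis
  proof (rule that[of "g \<circ> \<pi>"])
    show "(g \<circ> \<pi>) v \<in> H" if "i < r * s" "v \<in> P i" for i v
      using gH inU that by auto
  next
    fix h assume h: "h \<in> H"
    have im: "\<pi> ` {v \<in> ?U. (g \<circ> \<pi>) v = h} = {u \<in> ?U. g u = h}"
    proof (intro equalityI subsetI)
      fix x assume "x \<in> \<pi> ` {v \<in> ?U. (g \<circ> \<pi>) v = h}"
      then show "x \<in> {u \<in> ?U. g u = h}" using inU by auto
    next
      fix x assume x: "x \<in> {u \<in> ?U. g u = h}"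
      then have "x \<in> \<pi> ` ?U" using permutes_image[OF \<pi>(1)] by simp
      then show "x \<in> \<pi> ` {v \<in> ?U. (g \<circ> \<pi>) v = h}" using x by auto
    qed
    have "card {v \<in> ?U. (g \<circ> \<pi>) v = h} = card (\<pi> ` {v \<in> ?U. (g \<circ> \<pi>) v = h})"
      by (rule card_image[OF permutes_inj_on[OF \<pi>(1)], symmetric])
    also have "\<dots> = 8 * l * r" unfolding im by (rule fib[OF h])
    finally show "card {v \<in> ?U. (g \<circ> \<pi>) v = h} = 8 * l * r" .
  next
    fix J A
    assume J: "J \<subseteq> {..<r * s}" "J \<noteq> {}" "card J \<le> s div (16 * l)"
      and A: "A \<subseteq> (\<Union>i\<in>J. P i)" "4 * l * card J \<le> card A"
    show "l * card J < card ((g \<circ> \<pi>) ` A)"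
    proof (rule ccontr)
      assume small: "\<not> l * card J < card ((g \<circ> \<pi>) ` A)"
      \<comment> \<open>The union bound ranges over sets of the exact sizes $4lj$ and $lj$;
          shrinking the set of ports and enlarging the set of hubs preserves the failure.\<close>
      obtain A' where A': "A' \<subseteq> A" "card A' = 4 * l * card J"
        by (rule obtain_subset_with_card_n[OF A(2)])
      have "16 * l * card J \<le> 16 * l * (s div (16 * l))" using J(3) by (rule mult_le_mono2)
      also have "\<dots> \<le> s" by simp
      finally have js: "l * card J \<le> s" by linarith
      have AU: "A \<subseteq> ?U" using A(1) sub[OF J(1)] by (rule subset_trans)
      have AH: "(g \<circ> \<pi>) ` A \<subseteq> H" by (rule image_subsetI) (rule gpH, rule subsetD[OF AU])
      obtain T where T: "(g \<circ> \<pi>) ` A \<subseteq> T" "T \<subseteq> H" "card T = l * card J"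
        using exists_subset_between[of "(g \<circ> \<pi>) ` A" "l * card J" H] small js AH assms(1,2) by auto
      have "g ` \<pi> ` A' \<subseteq> g ` \<pi> ` A" using A'(1) by (intro image_mono)
      then have "\<pi> \<in> S A' T" using T(1) \<pi>(1) unfolding S_def image_comp by blast
      moreover have "(J, A', T) \<in> Q (card J)" using J(1) A(1) A' T unfolding Q_def by simp
      moreover have "card J \<in> {1..?j0}"
        using J finite_subset[OF J(1)] by (auto simp: Suc_le_eq card_gt_0_iff)
      ultimately have "\<pi> \<in> Bad1" unfolding Bad1_def
        by (intro UN_I[of "card J"] UN_I[of "(J, A', T)"]) auto
      then show False using \<pi>(2) by simp
    qed
  next
    fix J assume J: "J \<subseteq> {..<r * s}" "r * s \<le> 4 * card J"
    show "63 * s < 64 * card ((g \<circ> \<pi>) ` (\<Union>i\<in>J. P i))" (is "_ < 64 * card ?T")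
    proof (rule ccontr)
      assume small: "\<not> 63 * s < 64 * card ?T"
      have "?T \<subseteq> H" by (rule image_subsetI) (rule gpH, rule subsetD[OF sub[OF J(1)]])
      then have "(J, ?T) \<in> R" using J small by (auto simp: R_def)
      moreover have "\<pi> \<in> S (\<Union>i\<in>J. P i) ?T" using \<pi>(1) by (simp add: S_def image_comp)
      ultimately have "\<pi> \<in> Bad2" unfolding Bad2_def
        by (intro UN_I[of "(J, ?T)"]) auto
      then show False using \<pi>(3) by simp
    qed
  qed
qed

section \<open>Graphs of symmetric relations\<close>

definition graph_of_rel :: "'v set \<Rightarrow> ('v \<Rightarrow> 'v \<Rightarrow> bool) \<Rightarrow> ('v, 'v \<times> 'v) pre_digraph" where
  "graph_of_rel V E = \<lparr>verts = V, arcs = {(u, v) \<in> V \<times> V. E u v}, tail = fst, head = snd\<rparr>"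

lemma graph_of_rel_simps [simp]:
  "verts (graph_of_rel V E) = V"
  "arcs (graph_of_rel V E) = {(u, v) \<in> V \<times> V. E u v}"
  "tail (graph_of_rel V E) = fst"
  "head (graph_of_rel V E) = snd"
  by (simp_all add: graph_of_rel_def)

lemma dominates_graph_of_rel:
  "u \<rightarrow>\<^bsub>graph_of_rel V E\<^esub> v \<longleftrightarrow> u \<in> V \<and> v \<in> V \<and> E u v"
  by (auto simp: arcs_ends_conv)

lemma graph_graph_of_rel:
  assumes "finite V" "\<And>u v. E u v \<Longrightarrow> E v u" "\<And>v. \<not> E v v"
  shows "graph (graph_of_rel V E)"
proof unfold_locales
  show "finite (arcs (graph_of_rel V E))"
    by (rule finite_subset[of _ "V \<times> V"]) (use assms in auto)
  show "symmetric (graph_of_rel V E)"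
    using assms(2) by (auto simp: symmetric_conv)
qed (use assms in \<open>auto simp: arc_to_ends_def\<close>)

lemma out_degree_graph_of_rel:
  assumes "v \<in> V"
  shows "out_degree (graph_of_rel V E) v = card {w \<in> V. E v w}"
proof -
  have "out_arcs (graph_of_rel V E) v = Pair v ` {w \<in> V. E v w}"
    using assms by (auto simp: out_arcs_def)
  then show ?thesis by (simp add: out_degree_def card_image inj_on_def)
qed

section \<open>Closed walks and cycles\<close>

lemma (in pre_digraph) walk_outside_if_no_exit:
  assumes "cas u p v" "\<forall>e\<in>set p. tail G e \<in> W \<longrightarrow> head G e \<in> W" "v \<notin> W"
  shows "u \<notin> W \<and> (\<forall>e\<in>set p. head G e \<notin> W)"
  using assms by (induction p arbitrary: u) auto

lemma (in pre_digraph) walk_inside_if_no_exit: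
  assumes "cas u p v" "\<forall>e\<in>set p. tail G e \<in> W \<longrightarrow> head G e \<in> W" "u \<in> W"
  shows "\<forall>e\<in>set p. head G e \<in> W"
  using assms by (induction p arbitrary: u) auto

lemma (in pre_digraph) closed_walk_exits:
  assumes "cas u p u" "e \<in> set p" "head G e \<in> W" "e' \<in> set p" "head G e' \<notin> W"
  obtains a where "a \<in> set p" "tail G a \<in> W" "head G a \<notin> W"
proof (rule ccontr)
  assume "\<not> thesis"
  then have no: "\<forall>e\<in>set p. tail G e \<in> W \<longrightarrow> head G e \<in> W" using that by blast
  show False
  proof (cases "u \<in> W")
    case True
    then show ?thesis using walk_inside_if_no_exit[OF assms(1) no] assms by blast
  next
    case False
    then show ?thesis using walk_outside_if_no_exit[OF assms(1) no] assms by blast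
  qed
qed

text \<open>
  The definition of a cycle makes all vertices after the first one distinct; these are the
  heads of its arcs.
\<close>

lemma (in pre_digraph) cycle_distinct_heads:
  assumes "cycle p"
  obtains u where "cas u p u" "set p \<subseteq> arcs G" "distinct (map (head G) p)"
proof -
  obtain u where u: "cas u p u" "set p \<subseteq> arcs G" "distinct (tl (awalk_verts u p))" "p \<noteq> []"
    using assms unfolding cycle_def awalk_def by blast
  then show thesis using that awalk_verts_conv'[OF u(1)] by simp
qed

section \<open>Clusters joined through hubs\<close>

text \<open>
  The matching removed from the clique \<open>K i\<close> pairs each port \<open>v\<close> with \<open>mate v\<close>, so a port has $d - 1$
  neighbours in its cluster; the hub \<open>f v\<close> restores its degree to $d$.
\<close>

locale hub_clusters =
  fixes m d D :: nat and K P :: "nat \<Rightarrow> 'v set" and H :: "'v set" and mate f :: "'v \<Rightarrow> 'v"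
  assumes finite_H: "finite H"
    and finite_K: "i < m \<Longrightarrow> finite (K i)"
    and card_K: "i < m \<Longrightarrow> card (K i) = Suc d"
    and P_subset_K: "i < m \<Longrightarrow> P i \<subseteq> K i"
    and card_P: "i < m \<Longrightarrow> card (P i) = D"
    and K_unique: "i < m \<Longrightarrow> j < m \<Longrightarrow> v \<in> K i \<Longrightarrow> v \<in> K j \<Longrightarrow> i = j"
    and K_disj_H: "i < m \<Longrightarrow> v \<in> K i \<Longrightarrow> v \<notin> H"
    and mate: "i < m \<Longrightarrow> v \<in> P i \<Longrightarrow> mate v \<in> P i \<and> mate v \<noteq> v \<and> mate (mate v) = v"
    and f_in_H: "i < m \<Longrightarrow> v \<in> P i \<Longrightarrow> f v \<in> H"
    and f_fibre: "h \<in> H \<Longrightarrow> card {v \<in> (\<Union>i<m. P i). f v = h} = d"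
begin

definition V :: "'v set" where "V = (\<Union>i<m. K i) \<union> H"

definition clique_adj :: "'v \<Rightarrow> 'v \<Rightarrow> bool" where
  "clique_adj u v \<longleftrightarrow> (\<exists>i<m. u \<in> K i \<and> v \<in> K i \<and> u \<noteq> v \<and> (u \<in> P i \<longrightarrow> v \<noteq> mate u))"

definition hub_adj :: "'v \<Rightarrow> 'v \<Rightarrow> bool" where
  "hub_adj u v \<longleftrightarrow> (\<exists>i<m. u \<in> P i \<and> v = f u)"

definition adj :: "'v \<Rightarrow> 'v \<Rightarrow> bool" where
  "adj u v \<longleftrightarrow> clique_adj u v \<or> hub_adj u v \<or> hub_adj v u"

definition G :: "('v, 'v \<times> 'v) pre_digraph" where
  "G = graph_of_rel V adj"

lemma P_in_K: "i < m \<Longrightarrow> v \<in> P i \<Longrightarrow> v \<in> K i"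
  using P_subset_K by blast

lemma finite_P: "i < m \<Longrightarrow> finite (P i)"
  using P_subset_K finite_K finite_subset by blast

lemma finite_V: "finite V"
  unfolding V_def using finite_K finite_H by auto

lemma K_in_V: "i < m \<Longrightarrow> v \<in> K i \<Longrightarrow> v \<in> V" and H_in_V: "h \<in> H \<Longrightarrow> h \<in> V"
  unfolding V_def by auto

lemma clique_adj_sym: "clique_adj u v \<Longrightarrow> clique_adj v u"
  unfolding clique_adj_def by (metis mate)

lemma clique_adj_iff:
  assumes "i < m" "v \<in> K i"
  shows "clique_adj v w \<longleftrightarrow> w \<in> K i \<and> v \<noteq> w \<and> (v \<in> P i \<longrightarrow> w \<noteq> mate v)"
proof
  assume "clique_adj v w"
  then obtain j where j: "j < m" "v \<in> K j" "w \<in> K j" "v \<noteq> w" "v \<in> P j \<longrightarrow> w \<noteq> mate v"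
    unfolding clique_adj_def by blast
  moreover have "j = i" using K_unique assms j by blast
  ultimately show "w \<in> K i \<and> v \<noteq> w \<and> (v \<in> P i \<longrightarrow> w \<noteq> mate v)" by simp
qed (use assms in \<open>auto simp: clique_adj_def\<close>)

lemma clique_adj_notin_H:
  assumes "clique_adj u v"
  shows "u \<notin> H" "v \<notin> H"
  using assms K_disj_H unfolding clique_adj_def by auto

lemma hub_adjD:
  assumes "hub_adj u v"
  shows "u \<notin> H" "v \<in> H" "v = f u"
  using assms f_in_H P_in_K K_disj_H unfolding hub_adj_def by auto

lemma hub_adj_iff_port:
  assumes "i < m" "u \<in> K i"
  shows "hub_adj u v \<longleftrightarrow> u \<in> P i \<and> v = f u"
proof
  assume "hub_adj u v"
  then obtain j where j: "j < m" "u \<in> P j" "v = f u" unfolding hub_adj_def by blast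
  moreover have "j = i" using K_unique[OF j(1) assms(1) P_in_K[OF j(1,2)] assms(2)] .
  ultimately show "u \<in> P i \<and> v = f u" by simp
qed (use assms in \<open>auto simp: hub_adj_def\<close>)

lemma adj_iff_cluster:
  assumes "i < m" "v \<in> K i"
  shows "adj v w \<longleftrightarrow> (if v \<in> P i then w \<in> insert (f v) (K i - {v, mate v}) else w \<in> K i - {v})"
proof -
  have "\<not> hub_adj w v" using hub_adjD(2) K_disj_H[OF assms] by blast
  then show ?thesis
    unfolding adj_def clique_adj_iff[OF assms] hub_adj_iff_port[OF assms] by auto
qed

lemma graph_G: "graph G"
  unfolding G_def
proof (rule graph_graph_of_rel[OF finite_V])
  show "adj v u" if "adj u v" for u v
    using that clique_adj_sym unfolding adj_def by blast
  show "\<not> adj v v" for v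
  proof
    assume "adj v v"
    then have "clique_adj v v" using hub_adjD unfolding adj_def by blast
    then show False unfolding clique_adj_def by blast
  qed
qed

lemma nbrs_cluster:
  assumes "i < m" "v \<in> K i"
  shows "{w \<in> V. adj v w} = (if v \<in> P i then insert (f v) (K i - {v, mate v}) else K i - {v})"
  unfolding adj_iff_cluster[OF assms]
  using K_in_V[OF assms(1)] H_in_V[OF f_in_H[OF assms(1)]] by auto

lemma nbrs_hub:
  assumes "h \<in> H"
  shows "{w \<in> V. adj h w} = {v \<in> (\<Union>i<m. P i). f v = h}"
proof -
  have "adj h w \<longleftrightarrow> hub_adj w h" for w
    using clique_adj_notin_H hub_adjD assms unfolding adj_def by blast
  then show ?thesis
    using K_in_V P_in_K unfolding hub_adj_def by auto
qed

lemma regular_G: "regular G d"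
  unfolding regular_def
proof
  fix v assume "v \<in> verts G"
  then have v: "v \<in> V" by (simp add: G_def)
  have "card {w \<in> V. adj v w} = d"
  proof (cases "v \<in> H")
    case True
    then show ?thesis using nbrs_hub f_fibre by metis
  next
    case False
    then obtain i where i: "i < m" "v \<in> K i" using v unfolding V_def by blast
    show ?thesis
    proof (cases "v \<in> P i")
      case True
      have "mate v \<in> K i" "mate v \<noteq> v" using mate[OF i(1) True] P_in_K i(1) by auto
      moreover have "f v \<notin> K i" using f_in_H K_disj_H i(1) True by blast
      moreover have "Suc (card (K i - {v, mate v})) = d"
      proof -
        have "{v, mate v} \<subseteq> K i" using i \<open>mate v \<in> K i\<close> by simp
        then have "card (K i - {v, mate v}) = Suc d - 2" "2 \<le> Suc d"
          using card_K[OF i(1)] \<open>mate v \<noteq> v\<close> card_mono[OF finite_K[OF i(1)], of "{v, mate v}"]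
          by (auto simp: card_Diff_subset)
        then show ?thesis by simp
      qed
      ultimately show ?thesis
        using nbrs_cluster[OF i] True finite_K[OF i(1)] by simp
    next
      case False
      then show ?thesis
        using nbrs_cluster[OF i] card_K[OF i(1)] finite_K[OF i(1)] i(2) by simp
    qed
  qed
  then show "out_degree G v = d"
    unfolding G_def using out_degree_graph_of_rel[OF v] by simp
qed

lemma card_split:
  assumes "Y \<subseteq> V"
  shows "card Y = (\<Sum>i<m. card (Y \<inter> K i)) + card (Y \<inter> H)"
proof -
  have fY: "finite Y" by (rule finite_subset[OF assms finite_V])
  have "(\<Union>i<m. Y \<inter> K i) \<union> (Y \<inter> H) = Y" using assms unfolding V_def by blast
  then have "card Y = card ((\<Union>i<m. Y \<inter> K i) \<union> (Y \<inter> H))" by simp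
  also have "\<dots> = card (\<Union>i<m. Y \<inter> K i) + card (Y \<inter> H)"
    using fY K_disj_H by (intro card_Un_disjoint) auto
  also have "card (\<Union>i<m. Y \<inter> K i) = (\<Sum>i<m. card (Y \<inter> K i))"
    using fY K_unique by (intro card_UN_disjoint) fastforce+
  finally show ?thesis .
qed

lemma sum_card_le:
  assumes "Y \<subseteq> V" "I \<subseteq> {..<m}"
  shows "(\<Sum>i\<in>I. card (Y \<inter> K i)) \<le> card Y"
proof -
  have "(\<Sum>i\<in>I. card (Y \<inter> K i)) \<le> (\<Sum>i<m. card (Y \<inter> K i))"
    using assms(2) by (intro sum_mono2) auto
  then show ?thesis using card_split[OF assms(1)] by linarith
qed

lemma card_V: "card V = m * Suc d + card H"
proof -
  have "V \<inter> K i = K i" if "i < m" for i using that by (auto simp: V_def)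
  moreover have "V \<inter> H = H" by (auto simp: V_def)
  ultimately show ?thesis using card_split[of V] card_K by simp
qed

lemma exit_cluster_to_hub:
  assumes "adj u v" "i < m" "u \<in> K i" "v \<notin> K i"
  shows "v \<in> H"
  using assms f_in_H by (auto simp: adj_iff_cluster split: if_splits)

text \<open>
  Unless the cycle stays in one cluster, it leaves each cluster that it visits along some arc,
  whose head is a hub. Since the heads of the arcs are distinct, this maps the visited
  clusters injectively to hubs, so there are at most as many visited clusters as hubs.
\<close>

lemma cycle_length_le:
  assumes "pre_digraph.cycle G p" "H \<noteq> {}"
  shows "length p \<le> card H * (d + 2)"
proof -
  obtain u where p: "pre_digraph.cas G u p u" "set p \<subseteq> arcs G" "distinct (map (head G) p)"
    using pre_digraph.cycle_distinct_heads[OF assms(1)] by blast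
  let ?Y = "head G ` set p"
  have len: "length p = card ?Y"
    using distinct_card[OF p(3)] by simp
  have arcp: "head G e \<in> V \<and> adj (tail G e) (head G e)" if "e \<in> set p" for e
    using p(2) that unfolding G_def by auto
  have H1: "card H \<ge> 1" using assms(2) finite_H by (simp add: Suc_le_eq card_gt_0_iff)
  show ?thesis
  proof (cases "\<exists>i<m. ?Y \<subseteq> K i")
    case True
    then obtain i where "i < m" "?Y \<subseteq> K i" by blast
    then have "length p \<le> Suc d" using len card_mono[OF finite_K] card_K by metis
    also have "\<dots> \<le> card H * (d + 2)" using mult_le_mono1[OF H1, of "d + 2"] by simp
    finally show ?thesis .
  next
    case False
    define I where "I = {i. i < m \<and> ?Y \<inter> K i \<noteq> {}}"
    have "\<exists>a. a \<in> set p \<and> tail G a \<in> K i \<and> head G a \<in> H" if i: "i \<in> I" for i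
    proof -
      obtain e e' where e: "e \<in> set p" "head G e \<in> K i" "e' \<in> set p" "head G e' \<notin> K i"
        using False i unfolding I_def by blast
      obtain a where "a \<in> set p" "tail G a \<in> K i" "head G a \<notin> K i"
        using pre_digraph.closed_walk_exits[OF p(1) e] by blast
      then show ?thesis using exit_cluster_to_hub arcp i unfolding I_def by blast
    qed
    then obtain a where a: "\<And>i. i \<in> I \<Longrightarrow> a i \<in> set p \<and> tail G (a i) \<in> K i \<and> head G (a i) \<in> H"
      by metis
    have "inj_on (\<lambda>i. head G (a i)) I"
    proof (rule inj_onI)
      fix i j assume ij: "i \<in> I" "j \<in> I" "head G (a i) = head G (a j)"
      then have "a i = a j" using p(3) a by (simp add: distinct_map inj_on_def)
      then show "i = j" using a[OF ij(1)] a[OF ij(2)] K_unique ij unfolding I_def by auto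
    qed
    then have cI: "card I \<le> card H"
      using a finite_H by (intro card_inj_on_le[of "\<lambda>i. head G (a i)"]) auto
    have "?Y \<subseteq> V" using arcp by auto
    then have "card ?Y = (\<Sum>i<m. card (?Y \<inter> K i)) + card (?Y \<inter> H)" by (rule card_split)
    also have "(\<Sum>i<m. card (?Y \<inter> K i)) = (\<Sum>i\<in>I. card (?Y \<inter> K i))"
      by (rule sum.mono_neutral_right) (auto simp: I_def)
    also have "\<dots> \<le> (\<Sum>i\<in>I. Suc d)"
    proof (rule sum_mono)
      fix i assume "i \<in> I"
      then have "i < m" by (simp add: I_def)
      then show "card (?Y \<inter> K i) \<le> Suc d"
        using card_mono[OF finite_K, of i "?Y \<inter> K i"] card_K by simp
    qed
    also have "\<dots> \<le> card H * Suc d"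
      unfolding sum_constant of_nat_id using cI by (rule mult_le_mono1)
    also have "card (?Y \<inter> H) \<le> card H" using finite_H by (intro card_mono) auto
    finally show ?thesis using len by simp
  qed
qed

lemma circumference_le:
  assumes "H \<noteq> {}"
  shows "circumference G \<le> card H * (d + 2)"
proof -
  let ?L = "{length p |p. pre_digraph.cycle G p \<and> 3 \<le> length p}"
  have "x \<le> card H * (d + 2)" if "x \<in> ?L" for x
    using that cycle_length_le assms by blast
  then have "Sup ?L \<le> card H * (d + 2)"
    by (cases "?L = {}") (simp only: Sup_nat_empty le0, rule cSup_least)
  then show ?thesis unfolding circumference_def .
qed

lemma ext_nbhd_iff:
  "v \<in> ext_nbhd G X \<longleftrightarrow> v \<in> V \<and> v \<notin> X \<and> (\<exists>x\<in>X. x \<in> V \<and> adj v x)"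
  unfolding ext_nbhd_def G_def by (auto simp: dominates_graph_of_rel)

lemma ext_nbhd_subset_V: "ext_nbhd G X \<subseteq> V"
  using ext_nbhd_iff by blast

text \<open>
  A vertex of \<open>X\<close> in a cluster is adjacent to all other vertices of the cluster except possibly one,
  its mate.
\<close>

lemma cluster_missing_le:
  assumes "i < m" "X \<inter> K i \<noteq> {}"
  shows "card (K i - X) \<le> card (ext_nbhd G X \<inter> K i) + 1"
proof -
  obtain x where x: "x \<in> X" "x \<in> K i" using assms by blast
  have "K i - X \<subseteq> insert (mate x) (ext_nbhd G X \<inter> K i)"
  proof
    fix v assume v: "v \<in> K i - X"
    then have "v = mate x \<or> clique_adj x v"
      using x by (auto simp: clique_adj_iff[OF assms(1) x(2)])
    then have "v = mate x \<or> adj v x"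
      using clique_adj_sym unfolding adj_def by blast
    then show "v \<in> insert (mate x) (ext_nbhd G X \<inter> K i)"
      using v x K_in_V[OF assms(1)] by (auto simp: ext_nbhd_iff)
  qed
  then have "card (K i - X) \<le> card (insert (mate x) (ext_nbhd G X \<inter> K i))"
    using finite_K assms(1) by (intro card_mono) auto
  also have "\<dots> \<le> Suc (card (ext_nbhd G X \<inter> K i))" by (rule card_insert_le_m1) auto
  finally show ?thesis by simp
qed

lemma hub_of_port_in_ext_nbhd:
  assumes "i < m" "v \<in> P i" "v \<in> X" "f v \<notin> X"
  shows "f v \<in> ext_nbhd G X"
proof -
  have "hub_adj v (f v)" using assms unfolding hub_adj_def by blast
  then show ?thesis
    using assms H_in_V[OF f_in_H[OF assms(1,2)]] K_in_V[OF assms(1) P_in_K[OF assms(1,2)]]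
    unfolding ext_nbhd_iff adj_def by blast
qed

lemma port_of_hub_in_ext_nbhd:
  assumes "i < m" "v \<in> P i" "v \<notin> X" "f v \<in> X"
  shows "v \<in> ext_nbhd G X"
proof -
  have "hub_adj v (f v)" using assms unfolding hub_adj_def by blast
  then show ?thesis
    using assms H_in_V[OF f_in_H[OF assms(1,2)]] K_in_V[OF assms(1) P_in_K[OF assms(1,2)]]
    unfolding ext_nbhd_iff adj_def by blast
qed

text \<open>
  The $d$ ports attached to a hub of \<open>X\<close> lie in \<open>X\<close> or are neighbours of \<open>X\<close>, and different hubs have
  different ports.
\<close>

lemma many_hubs_expand:
  assumes "X \<subseteq> V"
  shows "d * card (X \<inter> H) \<le> card (ext_nbhd G X) + card X"
proof -
  have fX: "finite X" "finite (ext_nbhd G X)"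
    by (rule finite_subset[OF _ finite_V], rule assms ext_nbhd_subset_V)+
  let ?F = "\<lambda>h. {v \<in> (\<Union>i<m. P i). f v = h}"
  have fF: "finite (\<Union>i<m. P i)" using finite_P by auto
  have "card (\<Union>h\<in>X \<inter> H. ?F h) = (\<Sum>h\<in>X \<inter> H. card (?F h))"
    using fF finite_H by (intro card_UN_disjoint) auto
  also have "\<dots> = (\<Sum>h\<in>X \<inter> H. d)" by (intro sum.cong f_fibre) auto
  finally have "d * card (X \<inter> H) = card (\<Union>h\<in>X \<inter> H. ?F h)" by simp
  also have "\<dots> \<le> card (ext_nbhd G X \<union> X)"
    using fX port_of_hub_in_ext_nbhd by (intro card_mono) auto
  also have "\<dots> \<le> card (ext_nbhd G X) + card X" by (rule card_Un_le)
  finally show ?thesis .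
qed

text \<open>
  Let \<open>A\<close> be the set of clusters that \<open>X\<close> meets but fills only partly, missing at least $4l$
  vertices, and \<open>B\<close> the set of clusters that it nearly fills, so that \<open>X\<close> has
  more than half of their ports. One of the three parts of \<open>X\<close>, in \<open>A\<close>, in \<open>B\<close> and among the hubs, contains
  a third of it.

  The part in \<open>B\<close> is the interesting one. At most $j_0$ of these clusters are used, where $j_0$ is
  the largest size for which \<open>spread_few\<close> applies; that is the origin of the second
  alternative. The more than $lj$ hubs seen from $j$ clusters are neighbours or members of \<open>X\<close>. If
  half of them are members and all of \<open>B\<close> is used, their ports again outnumber \<open>X\<close>. If half are
  members and \<open>B\<close> is larger than $j_0$, then \<open>X\<close> contains a sixty-fourth of all hubs, and by
  \<open>spread_many\<close> fewer than a quarter of the clusters have no port attached to a hub of \<open>X\<close>. Since \<open>X\<close>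
  has at most half of the vertices, it nearly fills at most $5/8$ of the clusters. Each cluster
  outside these two families, and there are at least an eighth of all, contains a neighbour of \<open>X\<close>: a missing vertex if \<open>X\<close> meets it, and otherwise a port whose hub is in \<open>X\<close>.
\<close>

lemma expansion_dichotomy:
  assumes X: "X \<subseteq> V" "2 * card X \<le> card V"
    and params: "d = 8 * l * r" "D = 8 * l" "m = r * s" "card H = s"
    and large: "4 \<le> r" "14 \<le> l" "32 * l \<le> s"
    and spread_few: "\<And>J A. J \<subseteq> {..<m} \<Longrightarrow> J \<noteq> {} \<Longrightarrow> card J \<le> s div (16 * l) \<Longrightarrow> A \<subseteq> (\<Union>i\<in>J. P i) \<Longrightarrow>
           4 * l * card J \<le> card A \<Longrightarrow> l * card J < card (f ` A)"
    and spread_many: "\<And>J. J \<subseteq> {..<m} \<Longrightarrow> m \<le> 4 * card J \<Longrightarrow> 63 * s < 64 * card (f ` (\<Union>i\<in>J. P i))"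
  shows "card X \<le> 64 * r * card (ext_nbhd G X) \<or>
    m \<le> 64 * r * card (ext_nbhd G X) \<and> 7 * l * r * (s div (16 * l)) \<le> card X"
proof -
  let ?N = "ext_nbhd G X" and ?c = "card (X \<inter> H)" and ?j0 = "s div (16 * l)"
  have fin: "finite X" "finite ?N"
    by (rule finite_subset[OF _ finite_V], rule X ext_nbhd_subset_V)+
  define A where "A = {i. i < m \<and> X \<inter> K i \<noteq> {} \<and> 4 * l \<le> card (K i - X)}"
  define B where "B = {i. i < m \<and> card (K i - X) < 4 * l}"
  have AB: "A \<subseteq> {..<m}" "B \<subseteq> {..<m}" "finite A" "finite B" "A \<inter> B = {}"
    by (auto simp: A_def B_def)
  have N_ge_A: "3 * l * card A \<le> card ?N"
  proof -
    have "card A * (3 * l) = (\<Sum>i\<in>A. 3 * l)" by simp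
    also have "\<dots> \<le> (\<Sum>i\<in>A. card (?N \<inter> K i))"
    proof (rule sum_mono)
      fix i assume "i \<in> A"
      then show "3 * l \<le> card (?N \<inter> K i)"
        using cluster_missing_le[of i X] large by (auto simp: A_def)
    qed
    also have "\<dots> \<le> card ?N" by (rule sum_card_le[OF ext_nbhd_subset_V AB(1)])
    finally show ?thesis by (simp add: mult.commute)
  qed
  have x_le: "card X \<le> card A * Suc d + card B * Suc d + ?c"
  proof -
    have le: "card (X \<inter> K i) \<le> Suc d" if "i < m" for i
      using card_mono[OF finite_K, of i "X \<inter> K i"] card_K that by simp
    have "X \<inter> K i = {}" if "i < m" "i \<notin> A \<union> B" for i
      using that by (auto simp: A_def B_def)
    then have "(\<Sum>i<m. card (X \<inter> K i)) = (\<Sum>i\<in>A \<union> B. card (X \<inter> K i))"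
      using AB by (intro sum.mono_neutral_right) auto
    also have "\<dots> \<le> (\<Sum>i\<in>A \<union> B. Suc d)"
      using AB le by (intro sum_mono) auto
    also have "\<dots> = card A * Suc d + card B * Suc d"
      using AB by (simp add: card_Un_disjoint add_mult_distrib)
    finally show ?thesis using card_split[OF X(1)] by linarith
  qed
  have B_le_x: "card B * (7 * l * r + 1) \<le> card X"
  proof -
    have "card B * (7 * l * r + 1) = (\<Sum>i\<in>B. 7 * l * r + 1)" by simp
    also have "\<dots> \<le> (\<Sum>i\<in>B. card (X \<inter> K i))"
    proof (rule sum_mono)
      fix i assume "i \<in> B"
      then have i: "i < m" "card (K i - X) < 4 * l" by (auto simp: B_def)
      have "card (K i) = card (K i \<inter> X) + card (K i - X)"
        using finite_K[OF i(1)] by (metis card_Int_Diff add.commute)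
      moreover have "l * 4 \<le> l * r" using large(1) by (rule mult_le_mono2)
      ultimately show "7 * l * r + 1 \<le> card (X \<inter> K i)"
        using i card_K[OF i(1)] params(1) unfolding Int_commute[of X] mult.assoc by linarith
    qed
    also have "\<dots> \<le> card X" by (rule sum_card_le[OF X(1) AB(2)])
    finally show ?thesis .
  qed
  have "l * r \<noteq> 0" using large by simp
  then obtain q where q: "l * r = Suc q" using not0_implies_Suc by blast
  have d8: "d = 8 * (l * r)" using params(1) by simp
  have dc: "d * ?c \<le> card ?N + card X" by (rule many_hubs_expand[OF X(1)])
  have j0: "1 \<le> ?j0" "s \<le> 32 * l * ?j0"
  proof -
    have "16 * l > 0" using large by simp
    then have "16 * l * 2 \<le> s" "s < 16 * l * (?j0 + 1)" using large(3)
      by (auto simp: dividend_less_times_div)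
    then show "s \<le> 32 * l * ?j0" by (simp add: algebra_simps)
    show "1 \<le> ?j0" using large by (simp add: div_greater_zero_iff Suc_le_eq)
  qed
  consider (partial) "card X \<le> 3 * (card A * Suc d)" | (hubs) "card X \<le> 3 * ?c"
    | (empty) "card X = 0" | (full) "card X \<le> 3 * (card B * Suc d)" "B \<noteq> {}"
    using x_le by (cases "B = {}") fastforce+
  then show ?thesis
  proof cases
    case partial
    have "3 * Suc d \<le> 192 * (l * r)" unfolding d8 q by simp
    then have "card A * (3 * Suc d) \<le> card A * (192 * (l * r))" by (rule mult_le_mono2)
    moreover have "card X \<le> card A * (3 * Suc d)" using partial by (simp only: mult_ac)
    ultimately have "card X \<le> card A * (192 * (l * r))" by (rule order_trans[rotated])
    also have "\<dots> = 64 * r * (3 * l * card A)" by simp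
    also have "\<dots> \<le> 64 * r * card ?N" using N_ge_A by (rule mult_le_mono2)
    finally show ?thesis by simp
  next
    case hubs
    have "6 * ?c \<le> d * ?c" unfolding d8 q by (intro mult_le_mono1) simp
    then have "card X \<le> card ?N" using hubs dc by linarith
    also have "\<dots> \<le> 64 * r * card ?N" using large by simp
    finally show ?thesis by simp
  next
    case empty
    then show ?thesis by simp
  next
    case full
    define j where "j = min (card B) ?j0"
    obtain J where J: "J \<subseteq> B" "card J = j"
      using obtain_subset_with_card_n[of j B] by (auto simp: j_def)
    have Jm: "J \<subseteq> {..<m}" using J AB by blast
    have "j > 0" using j0 full AB by (simp add: j_def card_gt_0_iff)
    then have Jne: "J \<noteq> {}" using J by auto
    \<comment> \<open>At least half of the ports of \<open>J\<close>, because fewer than half are missing from \<open>X\<close> in each cluster.\<close>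
    define W where "W = (\<Union>i\<in>J. P i) \<inter> X"
    have "4 * l * card J = (\<Sum>i\<in>J. 4 * l)" by simp
    also have "\<dots> \<le> (\<Sum>i\<in>J. card (W \<inter> K i))"
    proof (rule sum_mono)
      fix i assume iJ: "i \<in> J"
      then have i: "i < m" "card (K i - X) < 4 * l" using J by (auto simp: B_def)
      have "card (P i) = card (P i \<inter> X) + card (P i - X)"
        using finite_P[OF i(1)] by (metis card_Int_Diff add.commute)
      moreover have "card (P i - X) \<le> card (K i - X)"
        using finite_K P_subset_K i(1) by (intro card_mono) auto
      moreover have "card (P i \<inter> X) \<le> card (W \<inter> K i)"
        using iJ P_in_K i(1) fin by (intro card_mono) (auto simp: W_def)
      ultimately show "4 * l \<le> card (W \<inter> K i)"
        using i(2) card_P[OF i(1)] params(2) by linarith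
    qed
    also have "\<dots> \<le> card W"
      using X by (intro sum_card_le Jm) (auto simp: W_def)
    finally have "l * card J < card (f ` W)"
      using Jm Jne J by (intro spread_few) (auto simp: j_def W_def)
    also have "\<dots> \<le> card ?N + ?c"
    proof -
      have "f ` W \<subseteq> ?N \<union> (X \<inter> H)"
      proof (rule image_subsetI)
        fix v assume "v \<in> W"
        then obtain i where "i < m" "v \<in> P i" "v \<in> X" using Jm by (auto simp: W_def)
        then show "f v \<in> ?N \<union> (X \<inter> H)"
          using hub_of_port_in_ext_nbhd f_in_H by blast
      qed
      then have "card (f ` W) \<le> card (?N \<union> (X \<inter> H))" using fin by (intro card_mono) auto
      then show ?thesis using card_Un_le[of ?N "X \<inter> H"] by linarith
    qed
    finally have lj: "l * j \<le> card ?N + ?c" using J by simp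
    have Sd: "Suc d \<le> 9 * (l * r)" unfolding d8 q by simp
    have x27: "card X \<le> 27 * r * (l * card B)"
    proof -
      have "card B * Suc d \<le> card B * (9 * (l * r))" using Sd by (rule mult_le_mono2)
      then show ?thesis using full(1) by (simp add: mult_ac)
    qed
    have x_j0: "7 * l * r * ?j0 \<le> card X" if "?j0 \<le> card B"
    proof -
      have "7 * l * r * ?j0 \<le> (7 * l * r + 1) * card B" using that by (intro mult_le_mono) auto
      then show ?thesis using B_le_x by (simp add: mult.commute)
    qed
    show ?thesis
    proof (cases "card B \<le> ?j0")
      case True
      then have jB: "j = card B" by (simp add: j_def)
      consider "l * j \<le> 2 * card ?N" | "l * j \<le> 2 * ?c" using lj by linarith
      then show ?thesis
      proof cases
        case 1
        then have "27 * r * (l * card B) \<le> 27 * r * (2 * card ?N)"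
          unfolding jB by (rule mult_le_mono2)
        with x27 have "card X \<le> 27 * r * (2 * card ?N)" by (rule order_trans)
        then have "card X \<le> 54 * (r * card ?N)" by simp
        then have "card X \<le> 64 * (r * card ?N)" by linarith
        then show ?thesis by (simp add: mult.assoc)
      next
        case 2
        then have "27 * r * (l * card B) \<le> 27 * r * (2 * ?c)"
          unfolding jB by (rule mult_le_mono2)
        with x27 have "card X \<le> 27 * r * (2 * ?c)" by (rule order_trans)
        then have "2 * card X \<le> 108 * r * ?c" by simp
        also have "\<dots> \<le> d * ?c"
          using large params(1) by (intro mult_le_mono1) simp
        finally have "card X \<le> card ?N" using dc by linarith
        also have "\<dots> \<le> 64 * r * card ?N" using large by simp
        finally show ?thesis by simp
      qed
    next
      case False
      then have jj: "j = ?j0" by (simp add: j_def)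
      have xx: "7 * l * r * ?j0 \<le> card X" using x_j0 False by simp
      consider "l * j \<le> 2 * card ?N" | "l * j \<le> 2 * ?c" using lj by linarith
      then have "m \<le> 64 * r * card ?N"
      proof cases
        case 1
        then have "s \<le> 64 * card ?N" using j0(2) unfolding jj by linarith
        then have "r * s \<le> r * (64 * card ?N)" by (rule mult_le_mono2)
        then show ?thesis using params by (simp add: mult_ac)
      next
        case 2
        then have c64: "s \<le> 64 * ?c" using j0(2) unfolding jj by linarith
        define U where "U = {i. i < m \<and> f ` P i \<inter> X = {}}"
        have U: "U \<subseteq> {..<m}" "finite U" by (auto simp: U_def)
        have "4 * card U < m"
        proof (rule ccontr)
          assume "\<not> 4 * card U < m"
          then have "63 * s < 64 * card (f ` (\<Union>i\<in>U. P i))" by (intro spread_many U) simp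
          also have "card (f ` (\<Union>i\<in>U. P i)) \<le> card (H - X)"
            using finite_H f_in_H by (intro card_mono) (auto simp: U_def)
          also have "card (H - X) = s - ?c"
            using finite_H params by (simp add: card_Diff_subset_Int Int_commute)
          finally show False using c64 by linarith
        qed
        moreover have "8 * card B \<le> 5 * m"
        proof (rule ccontr)
          assume "\<not> 8 * card B \<le> 5 * m"
          then have "(5 * m + 1) * (7 * l * r + 1) \<le> 8 * card B * (7 * l * r + 1)"
            by (intro mult_le_mono1) simp
          also have "\<dots> \<le> 8 * card X" using B_le_x by simp
          also have "\<dots> \<le> 4 * (m * Suc d + s)" using X(2) card_V params by simp
          also have "\<dots> \<le> 4 * (m * Suc d) + m" using large params by simp
          also have "\<dots> = 32 * (m * (l * r)) + 5 * m" using params(1) by (simp add: algebra_simps)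
          finally have "35 * (m * (l * r)) + 5 * m + 7 * (l * r) + 1 \<le> 32 * (m * (l * r)) + 5 * m"
            by (simp add: algebra_simps)
          then show False by simp
        qed
        moreover have "card ({..<m} - (U \<union> B)) \<le> card ?N"
        proof -
          have "card ({..<m} - (U \<union> B)) = (\<Sum>i\<in>{..<m} - (U \<union> B). 1)" by simp
          also have "\<dots> \<le> (\<Sum>i\<in>{..<m} - (U \<union> B). card (?N \<inter> K i))"
          proof (rule sum_mono)
            fix i assume i: "i \<in> {..<m} - (U \<union> B)"
            show "1 \<le> card (?N \<inter> K i)"
            proof (cases "X \<inter> K i = {}")
              case True
              obtain v where "v \<in> P i" "f v \<in> X" using i by (auto simp: U_def)
              moreover have "i < m" using i by simp
              moreover have "v \<in> K i" using calculation by (intro P_in_K)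
              ultimately have "v \<in> ?N \<inter> K i"
                using True by (auto intro: port_of_hub_in_ext_nbhd)
              then show ?thesis using fin by (auto simp: Suc_le_eq card_gt_0_iff)
            next
              case False
              then show ?thesis using i cluster_missing_le[of i X] large by (auto simp: B_def)
            qed
          qed
          also have "\<dots> \<le> card ?N" by (intro sum_card_le ext_nbhd_subset_V) auto
          finally show ?thesis .
        qed
        moreover have "m - (card U + card B) \<le> card ({..<m} - (U \<union> B))"
          using diff_card_le_card_Diff[of "U \<union> B" "{..<m}"] card_Un_le[of U B] U AB by simp
        ultimately have "m \<le> 8 * card ?N" by linarith
        also have "\<dots> \<le> 64 * r * card ?N" using large by (intro mult_le_mono1) simp
        finally show ?thesis .
      qed
      then show ?thesis using xx by simp
    qed
  qed
qed

end

section \<open>The construction on the natural numbers\<close>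

lemma block_div_mod:
  assumes "v \<in> {i * Suc d..<Suc i * Suc d}"
  shows "v div Suc d = i" "v = i * Suc d + v mod Suc d"
proof -
  obtain a where "v = i * Suc d + a" "a < Suc d"
    using assms by (metis add.commute add_less_cancel_left atLeastLessThan_iff le_Suc_ex mult_Suc)
  then show "v div Suc d = i" "v = i * Suc d + v mod Suc d"
    by (simp_all only: div_mult_self3 mod_mult_self3 div_less mod_less add_0_right nat.simps(3) if_False not_False_eq_True)
qed

text \<open>
  The clusters are consecutive blocks of $d+1$ numbers, followed by the hubs. The ports are the
  first $8l$ numbers of a block, matched by pairing each even offset with the next odd one.
\<close>

lemma hub_cluster_graph_exists:
  fixes l r s :: nat
  defines "d \<equiv> 8 * l * r"
  assumes large: "4 \<le> r" "14 \<le> l" "32 * l \<le> s"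
    and bounds: "4 * (r * s) \<le> 4 ^ l" "(63/64 :: real) ^ (2 * l) \<le> 1/16"
  obtains G :: "(nat, nat \<times> nat) pre_digraph"
  where "graph G" "card (verts G) = r * s * Suc d + s" "regular G d"
    "circumference G \<le> s * (d + 2)"
    "\<forall>X\<subseteq>verts G. 2 * card X \<le> card (verts G) \<longrightarrow>
       card X \<le> 64 * r * card (ext_nbhd G X) \<or>
       r * s \<le> 64 * r * card (ext_nbhd G X) \<and> 7 * l * r * (s div (16 * l)) \<le> card X"
proof -
  define K where "K i = {i * Suc d..<Suc i * Suc d}" for i
  define P where "P i = {i * Suc d..<i * Suc d + 8 * l}" for i
  define H where "H = {r * s * Suc d..<r * s * Suc d + s}"
  define mate where "mate v = (if even (v mod Suc d) then v + 1 else v - 1)" for v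
  have ld: "8 * l \<le> d" using large unfolding d_def by simp
  have Kdiv: "v div Suc d = i" if "v \<in> K i" for v i
    using block_div_mod(1)[of v i d] that unfolding K_def by blast
  have PK: "P i \<subseteq> K i" for i using ld by (auto simp: P_def K_def)
  have disj: "disjoint_family_on P {..<r * s}"
    unfolding disjoint_family_on_def using Kdiv PK by blast
  obtain f where f: "\<And>i v. i < r * s \<Longrightarrow> v \<in> P i \<Longrightarrow> f v \<in> H"
    "\<And>h. h \<in> H \<Longrightarrow> card {v \<in> (\<Union>i<r * s. P i). f v = h} = 8 * l * r"
    "\<And>J A. J \<subseteq> {..<r * s} \<Longrightarrow> J \<noteq> {} \<Longrightarrow> card J \<le> s div (16 * l) \<Longrightarrow> A \<subseteq> (\<Union>i\<in>J. P i) \<Longrightarrow>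
           4 * l * card J \<le> card A \<Longrightarrow> l * card J < card (f ` A)"
    "\<And>J. J \<subseteq> {..<r * s} \<Longrightarrow> r * s \<le> 4 * card J \<Longrightarrow> 63 * s < 64 * card (f ` (\<Union>i\<in>J. P i))"
    by (rule exists_spreading_attachment[of H s l r P])
      (use large bounds disj in \<open>auto simp: H_def P_def\<close>)
  have mate: "mate v \<in> P i \<and> mate v \<noteq> v \<and> mate (mate v) = v" if "v \<in> P i" for i v
  proof -
    define a where "a = v mod Suc d"
    have v: "v = i * Suc d + a" "a < 8 * l"
      using block_div_mod(2)[of v i d] that PK[of i] by (auto simp: K_def P_def a_def)
    have md: "(i * Suc d + b) mod Suc d = b" if "b < 8 * l" for b
      using that ld by (simp only: mod_mult_self3 mod_less)
    show ?thesis
    proof (cases "even a")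
      case True
      then have "a + 1 < 8 * l" using v(2) by presburger
      then show ?thesis using True v md[of a] md[of "a + 1"]
        by (simp add: mate_def P_def add.assoc)
    next
      case False
      then obtain b where "a = b + 1" using odd_pos by (metis Suc_eq_plus1 gr0_implies_Suc)
      then show ?thesis using False v md[of a] md[of b]
        by (simp add: mate_def P_def)
    qed
  qed
  interpret hub_clusters "r * s" d "8 * l" K P H mate f
  proof
    show "finite H" by (simp add: H_def)
    show "finite (K i)" for i by (simp add: K_def)
    show "card (K i) = Suc d" for i by (simp add: K_def)
    show "P i \<subseteq> K i" for i by (rule PK)
    show "card (P i) = 8 * l" for i by (simp add: P_def)
    show "i = j" if "v \<in> K i" "v \<in> K j" for i j v using Kdiv that by blast
    show "v \<notin> H" if "i < r * s" "v \<in> K i" for i v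
    proof -
      have "Suc i * Suc d \<le> r * s * Suc d" using that(1) by (intro mult_le_mono1) simp
      then show ?thesis using that(2) unfolding K_def H_def atLeastLessThan_iff by linarith
    qed
    show "mate v \<in> P i \<and> mate v \<noteq> v \<and> mate (mate v) = v" if "v \<in> P i" for i v
      by (rule mate[OF that])
    show "f v \<in> H" if "i < r * s" "v \<in> P i" for i v by (rule f(1)[OF that])
    show "card {v \<in> (\<Union>i<r * s. P i). f v = h} = d" if "h \<in> H" for h
      using f(2)[OF that] unfolding d_def .
  qed
  have cH: "card H = s" by (simp add: H_def)
  have VG: "verts G = V" by (simp add: G_def)
  show thesis
  proof (rule that[of G])
    show "card (verts G) = r * s * Suc d + s" unfolding VG card_V cH ..
    have "H \<noteq> {}" using large unfolding H_def by simp
    then show "circumference G \<le> s * (d + 2)" using circumference_le cH by simp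
    show "\<forall>X\<subseteq>verts G. 2 * card X \<le> card (verts G) \<longrightarrow>
       card X \<le> 64 * r * card (ext_nbhd G X) \<or>
       r * s \<le> 64 * r * card (ext_nbhd G X) \<and> 7 * l * r * (s div (16 * l)) \<le> card X"
      unfolding VG
      by (intro allI impI, rule expansion_dichotomy[OF _ _ d_def[THEN meta_eq_to_obj_eq] refl refl cH large f(3,4)])
  qed (rule graph_G regular_G)+
qed

section \<open>From the dichotomy to the expansion rate\<close>

text \<open>
  Since $15x/k \ge 15/2 \ge e$ for $x \ge k/2$, the rate never exceeds $\varepsilon_1 \le 1/(64r)$, which
  settles the first alternative. In the second one $15x/k$ is at least $s/(16l)$ rounded down,
  whose logarithm is at least $\sqrt d$. So the rate is at most $\varepsilon_1/d$, and $\varepsilon_1 |X|/d$ is at most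
  $\varepsilon_1 rs$, because $|X|$ is at most half of the number of vertices, hence at most $rsd$.
\<close>

lemma expander_of_dichotomy:
  fixes l r s :: nat and G :: "('a, 'b) pre_digraph" and e1 e2 :: real
  defines "d \<equiv> 8 * l * r"
  assumes pos: "0 < r" "0 < l" "0 < e1" "0 < e2" "e1 * (64 * real r) \<le> 1" "e2 \<le> 1"
    and n: "card (verts G) = r * s * Suc d + s"
    and j0: "exp (sqrt (real d)) \<le> real (s div (16 * l))"
    and dich: "\<forall>X\<subseteq>verts G. 2 * card X \<le> card (verts G) \<longrightarrow>
       card X \<le> 64 * r * card (ext_nbhd G X) \<or>
       r * s \<le> 64 * r * card (ext_nbhd G X) \<and> 7 * l * r * (s div (16 * l)) \<le> card X"
  shows "expander e1 (e2 * real d) G"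
  unfolding expander_def
proof (intro allI impI, elim conjE)
  fix X assume X: "X \<subseteq> verts G" "e2 * real d / 2 \<le> real (card X)"
    "real (card X) \<le> real (card (verts G)) / 2"
  let ?x = "real (card X)" and ?k = "e2 * real d" and ?N = "real (card (ext_nbhd G X))"
  let ?L = "ln (15 * ?x / ?k)"
  have d: "d \<ge> 2" using pos unfolding d_def by (cases l; cases r) auto
  have k: "?k > 0" using d pos by simp
  have "15 / 2 \<le> 15 * ?x / ?k" using X(2) k by (simp add: field_simps)
  moreover have "exp 1 \<le> (15 / 2 :: real)" using exp_le by linarith
  ultimately have "exp 1 \<le> 15 * ?x / ?k" by linarith
  then have L1: "1 \<le> ?L" using ln_ge_iff[of "15 * ?x / ?k" 1] k X(2)
    by (smt (verit) exp_gt_zero)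
  have rho: "rho e1 ?k ?x = e1 / ?L\<^sup>2" using X(2) k by (simp add: rho_def)
  have scale: "e1 * (64 * real r * ?N) \<le> ?N"
    using mult_right_mono[OF pos(5), of ?N] by (simp add: mult.assoc)
  have "2 * card X \<le> card (verts G)" using X(3) by linarith
  with dich X(1) have "card X \<le> 64 * r * card (ext_nbhd G X) \<or>
      r * s \<le> 64 * r * card (ext_nbhd G X) \<and> 7 * l * r * (s div (16 * l)) \<le> card X"
    by blast
  then show "rho e1 ?k ?x * ?x \<le> ?N"
  proof
    assume "card X \<le> 64 * r * card (ext_nbhd G X)"
    then have "?x \<le> real (64 * r * card (ext_nbhd G X))" by (simp only: of_nat_le_iff)
    then have x: "?x \<le> 64 * real r * ?N" by simp
    have "1 \<le> ?L\<^sup>2" using L1 by simp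
    then have "e1 / ?L\<^sup>2 \<le> e1 / 1" using pos by (intro divide_left_mono) auto
    then have "rho e1 ?k ?x * ?x \<le> e1 * ?x" unfolding rho by (intro mult_right_mono) auto
    also have "\<dots> \<le> e1 * (64 * real r * ?N)" using x pos by (intro mult_left_mono) auto
    finally show ?thesis using scale by linarith
  next
    assume a: "r * s \<le> 64 * r * card (ext_nbhd G X) \<and> 7 * l * r * (s div (16 * l)) \<le> card X"
    then have "real (r * s) \<le> real (64 * r * card (ext_nbhd G X))" by (simp only: of_nat_le_iff)
    then have m: "real (r * s) \<le> 64 * real r * ?N" by simp
    let ?j = "real (s div (16 * l))"
    have "real (7 * l * r * (s div (16 * l))) \<le> ?x" using a by (simp only: of_nat_le_iff)
    then have x: "7 * real (l * r) * ?j \<le> ?x" by simp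
    have "?j * ?k \<le> ?j * real d" using pos by (intro mult_left_mono) (auto intro: mult_left_le_one_le)
    also have "\<dots> = 8 * real (l * r) * ?j" by (simp add: d_def)
    also have "\<dots> \<le> 15 * (7 * real (l * r) * ?j)" by (simp add: mult_right_mono)
    also have "\<dots> \<le> 15 * ?x" using x by simp
    finally have "?j \<le> 15 * ?x / ?k" using k by (simp add: pos_le_divide_eq)
    then have "exp (sqrt (real d)) \<le> 15 * ?x / ?k" using j0 by linarith
    then have "sqrt (real d) \<le> ?L" using ln_ge_iff[of "15 * ?x / ?k"]
      by (smt (verit) exp_gt_zero)
    then have "(sqrt (real d))\<^sup>2 \<le> ?L\<^sup>2" by (intro power_mono) auto
    moreover have "0 < ?L\<^sup>2 * real d" using L1 d by simp
    ultimately have "e1 / ?L\<^sup>2 \<le> e1 / real d" using pos by (intro divide_left_mono) auto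
    then have "rho e1 ?k ?x * ?x \<le> e1 / real d * ?x" unfolding rho by (intro mult_right_mono) auto
    also have "\<dots> \<le> e1 / real d * (real (r * s) * real d)"
    proof (intro mult_left_mono)
      have "s \<le> r * s" using pos by simp
      then have "card (verts G) \<le> r * s * (d + 2)" using n by simp
      also have "\<dots> \<le> r * s * (2 * d)" using d by (intro mult_le_mono2) simp
      finally have "real (card (verts G)) \<le> real (r * s * (2 * d))" by (simp only: of_nat_le_iff)
      then show "?x \<le> real (r * s) * real d" using X(3) by simp
    qed (use pos in auto)
    also have "\<dots> = e1 * real (r * s)" using d by simp
    also have "\<dots> \<le> e1 * (64 * real r * ?N)" using m pos by (intro mult_left_mono) auto
    finally show ?thesis using scale by linarith
  qed
qed

section \<open>Choice of the parameters\<close>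

text \<open>
  There are $r(d+1)+1$ vertices per hub. They contribute only $O(\log d)$ to the logarithm of the
  number of vertices, so $s = \exp(\sqrt{2d})$ makes its square asymptotic to $2d$.
\<close>

definition num_hubs :: "nat \<Rightarrow> nat" where
  "num_hubs d = nat \<lfloor>exp (sqrt (2 * real d))\<rfloor>"

definition num_vertices :: "nat \<Rightarrow> nat \<Rightarrow> nat" where
  "num_vertices r d = r * num_hubs d * Suc d + num_hubs d"

lemma real_num_hubs: "real (num_hubs d) = of_int \<lfloor>exp (sqrt (2 * real d))\<rfloor>"
  unfolding num_hubs_def by (simp add: less_imp_le)

lemma degree_over_log_order_squared:
  assumes "0 < r"
  shows "(\<lambda>d. real d / (ln (real (num_vertices r d)))\<^sup>2 - 1/2) \<longlonglongrightarrow> 0"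
proof -
  have *: "real (num_vertices r d) = of_int \<lfloor>exp (sqrt (2 * real d))\<rfloor> * (real r * (real d + 1) + 1)" for d
    unfolding num_vertices_def by (simp add: real_num_hubs algebra_simps)
  have "0 < real r" using assms by simp
  then show ?thesis unfolding * by real_asymp (simp add: powr_half_sqrt)
qed

lemma eventually_parameters_large:
  assumes "0 < r"
  shows "eventually (\<lambda>l. 14 \<le> l \<and> 32 * l \<le> num_hubs (8 * l * r) \<and> 4 * (r * num_hubs (8 * l * r)) \<le> 4 ^ l \<and>
    (63/64 :: real) ^ (2 * l) \<le> 1/16 \<and>
    exp (sqrt (real (8 * l * r))) \<le> real (num_hubs (8 * l * r) div (16 * l))) sequentially"
proof -
  have r: "0 < real r" using assms by simp
  have "eventually (\<lambda>l::nat. 14 \<le> l) sequentially" by (rule eventually_ge_at_top)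
  moreover have "eventually (\<lambda>l. 32 * real l \<le> exp (sqrt (2 * real (8 * l * r))) - 1) sequentially"
    using r unfolding of_nat_mult by real_asymp
  moreover have "eventually (\<lambda>l. 4 * (real r * exp (sqrt (2 * real (8 * l * r)))) \<le> 4 ^ l) sequentially"
    using r unfolding of_nat_mult by real_asymp
  moreover have "eventually (\<lambda>l. (63/64 :: real) ^ (2 * l) \<le> 1/16) sequentially"
    by real_asymp
  moreover have "eventually (\<lambda>l. exp (sqrt (real (8 * l * r))) \<le>
      (exp (sqrt (2 * real (8 * l * r))) - 1) / (16 * real l) - 1) sequentially"
  proof -
    \<comment> \<open>In terms of \<open>y\<close>, the square root of the degree, the exponents are \<open>y\<close> and $\sqrt 2\,y$, and $7/5 < \sqrt 2$.\<close>
    have "eventually (\<lambda>y::real. exp y \<le> (exp (7/5 * y) - 1) / (16 * y\<^sup>2) - 1) at_top"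
      by real_asymp
    moreover have "filterlim (\<lambda>l. sqrt (real (8 * l * r))) at_top sequentially"
      using r unfolding of_nat_mult by real_asymp
    ultimately have "eventually (\<lambda>l. exp (sqrt (real (8 * l * r))) \<le>
      (exp (7/5 * sqrt (real (8 * l * r))) - 1) / (16 * (sqrt (real (8 * l * r)))\<^sup>2) - 1) sequentially"
      by (rule eventually_compose_filterlim)
    then show ?thesis
      using eventually_gt_at_top[of 0]
    proof eventually_elim
      case (elim l)
      let ?y = "sqrt (real (8 * l * r))"
      have "l * 1 \<le> l * (8 * r)" using assms by (intro mult_le_mono2) simp
      then have "real l \<le> real (8 * l * r)" by (simp only: of_nat_le_iff mult_ac mult_1)
      then have ly: "real l \<le> ?y\<^sup>2" by simp
      have "7/5 \<le> sqrt (2 :: real)" by (rule real_le_rsqrt) (simp add: power2_eq_square)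
      then have "7/5 * ?y \<le> sqrt 2 * ?y" by (rule mult_right_mono) simp
      also have "\<dots> = sqrt (2 * real (8 * l * r))" by (rule real_sqrt_mult[symmetric])
      finally have "exp (7/5 * ?y) \<le> exp (sqrt (2 * real (8 * l * r)))" by (simp only: exp_le_cancel_iff)
      then have "(exp (7/5 * ?y) - 1) / (16 * ?y\<^sup>2) \<le> (exp (sqrt (2 * real (8 * l * r))) - 1) / (16 * real l)"
        using elim(2) ly by (intro frac_le) (simp_all del: real_sqrt_pow2_iff)
      then show ?case using elim(1) by linarith
    qed
  qed
  ultimately show ?thesis
  proof eventually_elim
    case (elim l)
    let ?h = "num_hubs (8 * l * r)"
    have h: "real ?h \<le> exp (sqrt (2 * real (8 * l * r)))"
      "exp (sqrt (2 * real (8 * l * r))) - 1 \<le> real ?h"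
      unfolding real_num_hubs by linarith+
    have "real (32 * l) \<le> real ?h" using elim(2) h(2) by simp
    moreover have "real (4 * (r * ?h)) \<le> real (4 ^ l)"
    proof -
      have "real r * real ?h \<le> real r * exp (sqrt (2 * real (8 * l * r)))"
        using h(1) by (rule mult_left_mono) simp
      then show ?thesis using elim(3) by simp
    qed
    moreover have "exp (sqrt (real (8 * l * r))) \<le> real (?h div (16 * l))"
    proof -
      have "(exp (sqrt (2 * real (8 * l * r))) - 1) / (16 * real l) \<le> real ?h / (16 * real l)"
        using h(2) by (intro divide_right_mono) auto
      also have "\<dots> \<le> real (?h div (16 * l)) + 1"
      proof -
        have "16 * l > 0" using elim(1) by simp
        then have "?h \<le> 16 * l * (?h div (16 * l) + 1)"
          by (simp add: dividend_less_times_div less_imp_le)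
        then have "real ?h \<le> real (16 * l * (?h div (16 * l) + 1))" by (simp only: of_nat_le_iff)
        then show ?thesis using elim(1) by (simp add: field_simps)
      qed
      finally show ?thesis using elim(5) by linarith
    qed
    ultimately show ?case using elim(1,4) by (simp only: of_nat_le_iff)
  qed
qed

theorem theorem1p2:
  fixes \<eta> \<epsilon>\<^sub>2 :: real
  assumes "0 < \<eta>" and "\<eta> < 1 / 2"
    and "0 < \<epsilon>\<^sub>2" and "\<epsilon>\<^sub>2 < 1 / 20"
  shows "\<exists>\<epsilon>\<^sub>0 > 0. \<forall>\<epsilon>\<^sub>1. 0 < \<epsilon>\<^sub>1 \<and> \<epsilon>\<^sub>1 < \<epsilon>\<^sub>0 \<longrightarrow>
    (\<exists>err :: nat \<Rightarrow> real. err \<longlonglongrightarrow> 0 \<and>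
      infinite {(d, n). d > 0 \<and> n > 0 \<and>
        (\<exists>G :: (nat, nat \<times> nat) pre_digraph.
          graph G \<and> card (verts G) = n \<and> regular G d \<and>
          expander \<epsilon>\<^sub>1 (\<epsilon>\<^sub>2 * real d) G \<and>
          real (circumference G) < \<eta> * real n \<and>
          real d = (1 / 2 + err d) * (ln (real n))\<^sup>2)})"
proof -
  \<comment> \<open>With $\eta r > 2$ the circumference, at most $s(d+2)$, is less than $\eta r s (d+1)$.\<close>
  obtain r0 :: nat where "2 / \<eta> < real r0" using reals_Archimedean2 by blast
  define r where "r = max 4 r0"
  have r4: "4 \<le> r" and r\<eta>: "2 < \<eta> * real r"
  proof -
    have "2 / \<eta> < real r" using \<open>2 / \<eta> < real r0\<close> unfolding r_def by (simp add: less_max_iff_disj)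
    then show "2 < \<eta> * real r" using assms(1) by (simp add: field_simps)
  qed (simp add: r_def)
  define err where "err d = real d / (ln (real (num_vertices r d)))\<^sup>2 - 1/2" for d
  have err0: "err \<longlonglongrightarrow> 0"
    unfolding err_def using r4 by (intro degree_over_log_order_squared) simp
  obtain l0 where l0: "\<And>l. l \<ge> l0 \<Longrightarrow> 14 \<le> l \<and> 32 * l \<le> num_hubs (8 * l * r) \<and>
    4 * (r * num_hubs (8 * l * r)) \<le> 4 ^ l \<and> (63/64 :: real) ^ (2 * l) \<le> 1/16 \<and>
    exp (sqrt (real (8 * l * r))) \<le> real (num_hubs (8 * l * r) div (16 * l))"
    using eventually_parameters_large[of r] r4 unfolding eventually_sequentially by auto
  show ?thesis
  \<comment> \<open>The expansion that the dichotomy guarantees for all but the largest sets.\<close>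
  proof (intro exI[of _ "1 / (64 * real r)"] conjI allI impI)
    show "0 < 1 / (64 * real r)" using r4 by simp
    fix \<epsilon>\<^sub>1 :: real assume e1: "0 < \<epsilon>\<^sub>1 \<and> \<epsilon>\<^sub>1 < 1 / (64 * real r)"
    let ?S = "{(d, n). d > 0 \<and> n > 0 \<and>
        (\<exists>G :: (nat, nat \<times> nat) pre_digraph.
          graph G \<and> card (verts G) = n \<and> regular G d \<and>
          expander \<epsilon>\<^sub>1 (\<epsilon>\<^sub>2 * real d) G \<and>
          real (circumference G) < \<eta> * real n \<and>
          real d = (1 / 2 + err d) * (ln (real n))\<^sup>2)}"
    have "(8 * l * r, num_vertices r (8 * l * r)) \<in> ?S" if "l \<ge> l0" for l
    proof -
      define d where "d = 8 * l * r"
      define s where "s = num_hubs d"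
      have p: "14 \<le> l" "32 * l \<le> s" "4 * (r * s) \<le> 4 ^ l" "(63/64 :: real) ^ (2 * l) \<le> 1/16"
        "exp (sqrt (real d)) \<le> real (s div (16 * l))"
        using l0[OF that] unfolding s_def d_def by auto
      obtain G :: "(nat, nat \<times> nat) pre_digraph"
        where G: "graph G" "card (verts G) = r * s * Suc d + s" "regular G d"
          "circumference G \<le> s * (d + 2)"
          "\<forall>X\<subseteq>verts G. 2 * card X \<le> card (verts G) \<longrightarrow>
             card X \<le> 64 * r * card (ext_nbhd G X) \<or>
             r * s \<le> 64 * r * card (ext_nbhd G X) \<and> 7 * l * r * (s div (16 * l)) \<le> card X"
        unfolding d_def by (rule hub_cluster_graph_exists[OF r4 p(1-4)])
      have s0: "s > 0" using p by simp
      have d0: "d > 0" using p r4 unfolding d_def by simp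
      have n: "r * s * Suc d + s = num_vertices r d" unfolding num_vertices_def s_def ..
      have "expander \<epsilon>\<^sub>1 (\<epsilon>\<^sub>2 * real d) G"
        unfolding d_def
      proof (rule expander_of_dichotomy[where s = s and r = r])
        show "\<epsilon>\<^sub>1 * (64 * real r) \<le> 1" using e1 r4 by (simp add: field_simps)
      qed (use G p r4 e1 assms in \<open>auto simp: d_def\<close>)
      moreover have "real (circumference G) < \<eta> * real (num_vertices r d)"
      proof -
        have "real (circumference G) \<le> real (s * (d + 2))" using G(4) by (simp only: of_nat_le_iff)
        also have "\<dots> \<le> 2 * (real s * real (Suc d))" by (simp add: algebra_simps)
        also have "\<dots> < \<eta> * real r * (real s * real (Suc d))"
          using r\<eta> s0 by (intro mult_strict_right_mono) auto
        also have "\<dots> \<le> \<eta> * real (num_vertices r d)"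
          unfolding n[symmetric] using assms(1) by (simp add: algebra_simps)
        finally show ?thesis .
      qed
      moreover have "real d = (1 / 2 + err d) * (ln (real (num_vertices r d)))\<^sup>2"
      proof -
        have "1 < s" using p by simp
        then have "1 < num_vertices r d" using n by linarith
        then have "ln (real (num_vertices r d)) \<noteq> 0" by simp
        then show ?thesis unfolding err_def by simp
      qed
      moreover have "num_vertices r d > 0" using s0 n by linarith
      moreover have "card (verts G) = num_vertices r d" using G(2) n by simp
      ultimately show ?thesis
        unfolding d_def[symmetric] mem_Collect_eq case_prod_conv
        using G(1,3) d0 by (intro conjI exI[of _ G]) simp_all
    qed
    then have "(\<lambda>l. (8 * l * r, num_vertices r (8 * l * r))) ` {l0..} \<subseteq> ?S"
      by (intro image_subsetI) (simp only: atLeast_iff)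
    moreover have "inj_on (\<lambda>l. (8 * l * r, num_vertices r (8 * l * r))) {l0..}"
      using r4 by (intro inj_onI) simp
    then have "infinite ((\<lambda>l. (8 * l * r, num_vertices r (8 * l * r))) ` {l0..})"
      by (simp add: finite_image_iff infinite_Ici)
    ultimately have "infinite ?S" by (rule infinite_super)
    then show "\<exists>err :: nat \<Rightarrow> real. err \<longlonglongrightarrow> 0 \<and>
      infinite {(d, n). d > 0 \<and> n > 0 \<and>
        (\<exists>G :: (nat, nat \<times> nat) pre_digraph.
          graph G \<and> card (verts G) = n \<and> regular G d \<and>
          expander \<epsilon>\<^sub>1 (\<epsilon>\<^sub>2 * real d) G \<and>
          real (circumference G) < \<eta> * real n \<and>
          real d = (1 / 2 + err d) * (ln (real n))\<^sup>2)}"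
      using err0 by (intro exI[of _ err] conjI)
  qed
qed

end
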